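(* Let $X$ be a diffeological space and let $x\in X$. If $X$ is smoothly regular at $x$, then there is an isomorphism of real vector spaces $$\hat{\mathbb{T}}_x(X)\cong \hat T_x(X)$$ between the global external tangent space and the external tangent space of $X$ at $x$. This isomorphism is induced (by restriction) from the isomorphism $\hat{\mathbb{T}}^R_x(X)\cong\hat T^R_x(X)$ between the global right tangent space and the right tangent space given, in the direction $\hat T^R_x(X)\to\hat{\mathbb{T}}^R_x(X)$, by $D\mapsto \bigl(g\mapsto D([g,X])\bigr)$ for $g\in C^\infty(X,\mathbb{R})$.
   Context: A Euclidean open set is an open subset of $\mathbb{R}^n$ for some $n\ge 0$. A parametrization of a set $X$ is a map $U\to X$ with $U$ a Euclidean open set. A diffeology on $X$ is a set of parametrizations, called plots, such that: every constant parametrization is a plot; a parametrization $U\to X$ that restricts to a plot on each member of some open cover of $U$ is a plot; if $p\colon U\to X$ is a plot and $f\colon V\to U$ is a $C^\infty$ map from a Euclidean open set, then $p\circ f$ is a plot. A diffeological space is a set with a diffeology. A map $f\colon X\to Y$ of diffeological spaces is smooth if $f\circ p$ is a plot of $Y$ for every plot $p$ of $X$. Euclidean open sets carry the diffeology of all $C^\infty$ parametrizations. The $D$-topology on $X$ is the largest topology making all plots continuous; its open sets are called $D$-open. A subset $Y\subset X$ carries the subdiffeology: the parametrizations of $Y$ that are plots of $X$. A product carries the diffeology whose plots are the maps with all components plots. $C^\infty(X,Y)$, the set of smooth maps, carries the functional diffeology: $p\colon U\to C^\infty(X,Y)$ is a plot iff $U\times X\to Y$, $(u,x)\mapsto p(u)(x)$,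 is smooth. $X$ is smoothly regular at $x$ (for its $D$-topology) if for every $D$-open neighbourhood $U$ of $x$ there is a smooth map $\lambda\colon X\to\mathbb{R}$ with $\lambda(x)=1$ and $\lambda(y)=0$ for all $y\notin U$. $G(X,x)$ denotes the $\mathbb{R}$-algebra of germs $[g,B]$ at $x$ of smooth functions $g\colon B\to\mathbb{R}$, $B$ a $D$-open neighbourhood of $x$ (two functions are identified if they agree on a $D$-open neighbourhood of $x$). It carries the quotient diffeology of the sum diffeology on $\coprod_{B}C^\infty(B,\mathbb{R})$ ($B$ ranging over $D$-open neighbourhoods of $x$); thus a map $D\colon G(X,x)\to\mathbb{R}$ is smooth iff for every such $B$ the map $C^\infty(B,\mathbb{R})\to\mathbb{R}$, $g\mapsto D([g,B])$, is smooth. The right tangent space $\hat T^R_x(X)$ is the vector space of linear maps $D\colon G(X,x)\to\mathbb{R}$ with $D([g,B]\,[h,B'])=g(x)D([h,B'])+h(x)D([g,B])$; the external tangent space $\hat T_x(X)\subset\hat T^R_x(X)$ is the subspace of those $D$ that are smooth maps. The global right tangent space $\hat{\mathbb{T}}^R_x(X)$ is the vector space of linear maps $D\colon C^\infty(X,\mathbb{R})\to\mathbb{R}$ with $D(gh)=g(x)D(h)+h(x)D(g)$; the global external tangent space $\hat{\mathbb{T}}_x(X)\subset\hat{\mathbb{T}}^R_x(X)$ is the subspace of those $D$ that are smooth maps. *)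

theory Defs
  imports "HOL-Analysis.Analysis" "HOL-Algebra.Module"
begin

section \<open>Smooth functions on Euclidean open sets\<close>

text \<open>
  The dimension of a Euclidean open set varies, so \<open>\<real>\<^sup>n\<close> is the space \<^term>\<open>Euclidean_space n\<close> of
  sequences vanishing from index \<open>n\<close> on, and a Euclidean open set is a pair of a dimension \<open>n\<close>
  and a set \<open>U\<close> with \<^term>\<open>openin (Euclidean_space n) U\<close>.

  \<open>Ck k n U f\<close> says that \<open>f\<close> is \<open>k\<close> times continuously differentiable on \<open>U\<close>; the function
  \<open>f'\<close> below is the \<open>i\<close>-th partial derivative. Only the values of \<open>f\<close> on \<open>U\<close> matter.
\<close>

primrec Ck :: "nat \<Rightarrow> nat \<Rightarrow> (nat \<Rightarrow> real) set \<Rightarrow> ((nat \<Rightarrow> real) \<Rightarrow> real) \<Rightarrow> bool" where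
  "Ck 0 n U f \<longleftrightarrow> continuous_map (subtopology (Euclidean_space n) U) euclideanreal f"
| "Ck (Suc k) n U f \<longleftrightarrow>
     continuous_map (subtopology (Euclidean_space n) U) euclideanreal f \<and>
     (\<forall>i<n. \<exists>f'. (\<forall>u\<in>U. ((\<lambda>t. f (u(i := t))) has_real_derivative f' u) (at (u i))) \<and> Ck k n U f')"

definition Cinf :: "nat \<Rightarrow> (nat \<Rightarrow> real) set \<Rightarrow> ((nat \<Rightarrow> real) \<Rightarrow> real) \<Rightarrow> bool" where
  "Cinf n U f \<longleftrightarrow> (\<forall>k. Ck k n U f)"

definition Cinf_map ::
  "nat \<Rightarrow> (nat \<Rightarrow> real) set \<Rightarrow> nat \<Rightarrow> (nat \<Rightarrow> real) set \<Rightarrow> ((nat \<Rightarrow> real) \<Rightarrow> nat \<Rightarrow> real) \<Rightarrow> bool" where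
  "Cinf_map m V n U f \<longleftrightarrow> f \<in> V \<rightarrow> U \<and> (\<forall>i<n. Cinf m V (\<lambda>v. f v i))"


section \<open>Diffeological spaces\<close>

text \<open>
  A parametrization \<open>U \<rightarrow> X\<close> is a triple \<open>(n, U, p)\<close> with \<open>U\<close> open in \<open>\<real>\<^sup>n\<close> and \<open>p\<close> extensional,
  that is, \<^term>\<open>undefined\<close> outside \<open>U\<close>, so that equality of triples is equality of maps.
\<close>

type_synonym 'a parametrization = "nat \<times> (nat \<Rightarrow> real) set \<times> ((nat \<Rightarrow> real) \<Rightarrow> 'a)"

definition parametrizations :: "'a set \<Rightarrow> 'a parametrization set" where
  "parametrizations S = {(n, U, p). openin (Euclidean_space n) U \<and> p \<in> U \<rightarrow>\<^sub>E S}"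

record 'a dspace =
  points :: "'a set"
  plots :: "'a parametrization set"

definition diffeological_space :: "'a dspace \<Rightarrow> bool" where
  "diffeological_space X \<longleftrightarrow>
     plots X \<subseteq> parametrizations (points X) \<and>
     (\<forall>n U c. openin (Euclidean_space n) U \<and> c \<in> points X \<longrightarrow> (n, U, \<lambda>u\<in>U. c) \<in> plots X) \<and>
     (\<forall>n U p \<C>. (n, U, p) \<in> parametrizations (points X) \<and>
        (\<forall>V\<in>\<C>. openin (Euclidean_space n) V \<and> (n, V, restrict p V) \<in> plots X) \<and> \<Union>\<C> = U
        \<longrightarrow> (n, U, p) \<in> plots X) \<and>
     (\<forall>n U p m V f. (n, U, p) \<in> plots X \<and> openin (Euclidean_space m) V \<and> Cinf_map m V n U f
        \<longrightarrow> (m, V, compose V p f) \<in> plots X)"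

definition smooth_map :: "'a dspace \<Rightarrow> 'b dspace \<Rightarrow> ('a \<Rightarrow> 'b) \<Rightarrow> bool" where
  "smooth_map X Y f \<longleftrightarrow>
     f \<in> points X \<rightarrow> points Y \<and> (\<forall>(n, U, p) \<in> plots X. (n, U, compose U f p) \<in> plots Y)"

definition euclidean_dspace :: "nat \<Rightarrow> (nat \<Rightarrow> real) set \<Rightarrow> (nat \<Rightarrow> real) dspace" where
  "euclidean_dspace n U =
     \<lparr>points = U, plots = {(m, V, f) \<in> parametrizations U. Cinf_map m V n U f}\<rparr>"

text \<open>The real line is given on the type of reals rather than on \<^term>\<open>Euclidean_space 1\<close>.\<close>

definition real_line :: "real dspace" where
  "real_line = \<lparr>points = UNIV, plots = {(m, V, f) \<in> parametrizations UNIV. Cinf m V f}\<rparr>"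

definition sub_dspace :: "'a dspace \<Rightarrow> 'a set \<Rightarrow> 'a dspace" where
  "sub_dspace X Y = \<lparr>points = Y, plots = plots X \<inter> parametrizations Y\<rparr>"

definition prod_dspace :: "'a dspace \<Rightarrow> 'b dspace \<Rightarrow> ('a \<times> 'b) dspace" where
  "prod_dspace X Y =
     \<lparr>points = points X \<times> points Y,
      plots = {(n, U, p) \<in> parametrizations (points X \<times> points Y).
        (n, U, compose U fst p) \<in> plots X \<and> (n, U, compose U snd p) \<in> plots Y}\<rparr>"

text \<open>\<open>C\<^sup>\<infinity>(X, Y)\<close> with the functional diffeology; its points are extensional functions.\<close>

definition smooth_maps :: "'a dspace \<Rightarrow> 'b dspace \<Rightarrow> ('a \<Rightarrow> 'b) set" where
  "smooth_maps X Y = {f \<in> points X \<rightarrow>\<^sub>E points Y. smooth_map X Y f}"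

definition function_dspace :: "'a dspace \<Rightarrow> 'b dspace \<Rightarrow> ('a \<Rightarrow> 'b) dspace" where
  "function_dspace X Y =
     \<lparr>points = smooth_maps X Y,
      plots = {(n, U, p) \<in> parametrizations (smooth_maps X Y).
        smooth_map (prod_dspace (euclidean_dspace n U) X) Y (\<lambda>(u, x). p u x)}\<rparr>"

text \<open>
  The sum diffeology is the smallest one making the injections smooth: its plots take values in
  a single summand, and are plots of that summand, locally on \<open>U\<close>. The quotient diffeology is the
  smallest one making the projection smooth: its plots are those that lift locally.
\<close>

definition sum_dspace :: "'i set \<Rightarrow> ('i \<Rightarrow> 'a dspace) \<Rightarrow> ('i \<times> 'a) dspace" where
  "sum_dspace I X =
     \<lparr>points = Sigma I (\<lambda>i. points (X i)),
      plots = {(n, U, p) \<in> parametrizations (Sigma I (\<lambda>i. points (X i))).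
        \<forall>u\<in>U. \<exists>V i q. openin (Euclidean_space n) V \<and> u \<in> V \<and> V \<subseteq> U \<and>
          i \<in> I \<and> (n, V, q) \<in> plots (X i) \<and> (\<forall>v\<in>V. p v = (i, q v))}\<rparr>"

definition quotient_dspace :: "'a dspace \<Rightarrow> ('a \<times> 'a) set \<Rightarrow> 'a set dspace" where
  "quotient_dspace X r =
     \<lparr>points = points X // r,
      plots = {(n, U, p) \<in> parametrizations (points X // r).
        \<forall>u\<in>U. \<exists>V q. openin (Euclidean_space n) V \<and> u \<in> V \<and> V \<subseteq> U \<and>
          (n, V, q) \<in> plots X \<and> (\<forall>v\<in>V. p v = r `` {q v})}\<rparr>"


section \<open>The D-topology and smooth regularity\<close>

definition D_topology :: "'a dspace \<Rightarrow> 'a topology" where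
  "D_topology X = topology (\<lambda>A. A \<subseteq> points X \<and>
     (\<forall>(n, U, p) \<in> plots X. openin (Euclidean_space n) {u \<in> U. p u \<in> A}))"

lemma openin_D_topology:
  "openin (D_topology X) A \<longleftrightarrow>
     A \<subseteq> points X \<and> (\<forall>(n, U, p) \<in> plots X. openin (Euclidean_space n) {u \<in> U. p u \<in> A})"
proof -
  have "istopology (\<lambda>A. A \<subseteq> points X \<and>
     (\<forall>(n, U, p) \<in> plots X. openin (Euclidean_space n) {u \<in> U. p u \<in> A}))"
    unfolding istopology_def
  proof (intro conjI allI impI)
    fix S T
    assume S: "S \<subseteq> points X \<and>
        (\<forall>(n, U, p) \<in> plots X. openin (Euclidean_space n) {u \<in> U. p u \<in> S})"
      and T: "T \<subseteq> points X \<and>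
        (\<forall>(n, U, p) \<in> plots X. openin (Euclidean_space n) {u \<in> U. p u \<in> T})"
    show "S \<inter> T \<subseteq> points X" using S by blast
    have eq: "{u \<in> U. p u \<in> S \<inter> T} = {u \<in> U. p u \<in> S} \<inter> {u \<in> U. p u \<in> T}"
      for U and p :: "(nat \<Rightarrow> real) \<Rightarrow> 'a" by blast
    show "\<forall>(n, U, p) \<in> plots X. openin (Euclidean_space n) {u \<in> U. p u \<in> S \<inter> T}"
      unfolding eq using S T by (fast intro: openin_Int)
  next
    fix \<K>
    assume K: "\<forall>K\<in>\<K>. K \<subseteq> points X \<and>
        (\<forall>(n, U, p) \<in> plots X. openin (Euclidean_space n) {u \<in> U. p u \<in> K})"
    show "\<Union>\<K> \<subseteq> points X" using K by blast
    have eq: "{u \<in> U. p u \<in> \<Union>\<K>} = (\<Union>K\<in>\<K>. {u \<in> U. p u \<in> K})"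
      for U and p :: "(nat \<Rightarrow> real) \<Rightarrow> 'a" by blast
    show "\<forall>(n, U, p) \<in> plots X. openin (Euclidean_space n) {u \<in> U. p u \<in> \<Union>\<K>}"
      unfolding eq using K by (fast intro: openin_Union)
  qed
  then show ?thesis
    by (simp add: D_topology_def topology_inverse')
qed

lemma D_topology_makes_plots_continuous:
  assumes "diffeological_space X" "(n, U, p) \<in> plots X"
  shows "continuous_map (subtopology (Euclidean_space n) U) (D_topology X) p"
proof -
  have U: "openin (Euclidean_space n) U" and p: "p \<in> U \<rightarrow> points X"
    using assms by (auto simp: diffeological_space_def parametrizations_def)
  have pU: "{u \<in> V. q u \<in> points X} = V" "openin (Euclidean_space m) V"
    if "(m, V, q) \<in> plots X" for m V q
    using that assms(1) by (auto simp: diffeological_space_def parametrizations_def)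
  then have "openin (D_topology X) (points X)"
    by (auto simp: openin_D_topology)
  then have top: "topspace (D_topology X) = points X"
    by (meson openin_D_topology openin_subset openin_topspace subset_antisym)
  have "openin (Euclidean_space n) {u \<in> U. p u \<in> A}" if "openin (D_topology X) A" for A
    using that assms(2) by (auto simp: openin_D_topology)
  moreover have "topspace (Euclidean_space n) \<inter> U = U"
    using openin_subset[OF U] by blast
  ultimately show ?thesis
    using U p by (auto simp: continuous_map_def top openin_open_subtopology)
qed

lemma D_topology_largest:
  assumes "topspace T = points X" "diffeological_space X"
    and "\<And>n U p. (n, U, p) \<in> plots X \<Longrightarrow>
      continuous_map (subtopology (Euclidean_space n) U) T p"
    and "openin T A"
  shows "openin (D_topology X) A"
proof -
  have "openin (Euclidean_space n) {u \<in> U. p u \<in> A}" if P: "(n, U, p) \<in> plots X" for n U p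
  proof -
    have U: "openin (Euclidean_space n) U"
      using P assms(2) by (auto simp: diffeological_space_def parametrizations_def)
    show ?thesis
      using openin_continuous_map_preimage[OF assms(3)[OF P] assms(4)] U openin_subset[OF U]
      by (simp add: openin_open_subtopology Int_absorb1)
  qed
  then show ?thesis
    using openin_subset[OF assms(4)] assms(1) by (auto simp: openin_D_topology)
qed

definition D_nbhds :: "'a dspace \<Rightarrow> 'a \<Rightarrow> 'a set set" where
  "D_nbhds X x = {B. openin (D_topology X) B \<and> x \<in> B}"

definition smoothly_regular_at :: "'a dspace \<Rightarrow> 'a \<Rightarrow> bool" where
  "smoothly_regular_at X x \<longleftrightarrow>
     (\<forall>U \<in> D_nbhds X x. \<exists>l. smooth_map X real_line l \<and> l x = 1 \<and> (\<forall>y \<in> points X - U. l y = 0))"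


section \<open>Algebras of smooth functions and of germs\<close>

definition smooth_algebra :: "'a dspace \<Rightarrow> (real, 'a \<Rightarrow> real) module" where
  "smooth_algebra X =
     \<lparr>carrier = smooth_maps X real_line,
      mult = (\<lambda>g h. \<lambda>y\<in>points X. g y * h y),
      one = (\<lambda>y\<in>points X. 1),
      zero = (\<lambda>y\<in>points X. 0),
      add = (\<lambda>g h. \<lambda>y\<in>points X. g y + h y),
      smult = (\<lambda>c g. \<lambda>y\<in>points X. c * g y)\<rparr>"

text \<open>The points of \<open>local_functions X x\<close> are the pairs \<open>(B, g)\<close> whose germs are taken.\<close>

definition local_functions :: "'a dspace \<Rightarrow> 'a \<Rightarrow> ('a set \<times> ('a \<Rightarrow> real)) dspace" where
  "local_functions X x = sum_dspace (D_nbhds X x) (\<lambda>B. function_dspace (sub_dspace X B) real_line)"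

definition germ_rel ::
  "'a dspace \<Rightarrow> 'a \<Rightarrow> (('a set \<times> ('a \<Rightarrow> real)) \<times> ('a set \<times> ('a \<Rightarrow> real))) set" where
  "germ_rel X x =
     {((B, g), (B', h)). (B, g) \<in> points (local_functions X x) \<and>
        (B', h) \<in> points (local_functions X x) \<and>
        (\<exists>W \<in> D_nbhds X x. W \<subseteq> B \<inter> B' \<and> (\<forall>y\<in>W. g y = h y))}"

type_synonym 'a germ = "('a set \<times> ('a \<Rightarrow> real)) set"

definition germ :: "'a dspace \<Rightarrow> 'a \<Rightarrow> 'a set \<Rightarrow> ('a \<Rightarrow> real) \<Rightarrow> 'a germ" where
  "germ X x B g = germ_rel X x `` {(B, g)}"

definition germ_dspace :: "'a dspace \<Rightarrow> 'a \<Rightarrow> 'a germ dspace" where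
  "germ_dspace X x = quotient_dspace (local_functions X x) (germ_rel X x)"

definition germ_algebra :: "'a dspace \<Rightarrow> 'a \<Rightarrow> (real, 'a germ) module" where
  "germ_algebra X x =
     \<lparr>carrier = points (germ_dspace X x),
      mult = (\<lambda>\<gamma> \<delta>. \<Union>(B, g)\<in>\<gamma>. \<Union>(B', h)\<in>\<delta>. germ X x (B \<inter> B') (\<lambda>y\<in>B \<inter> B'. g y * h y)),
      one = germ X x (points X) (\<lambda>y\<in>points X. 1),
      zero = germ X x (points X) (\<lambda>y\<in>points X. 0),
      add = (\<lambda>\<gamma> \<delta>. \<Union>(B, g)\<in>\<gamma>. \<Union>(B', h)\<in>\<delta>. germ X x (B \<inter> B') (\<lambda>y\<in>B \<inter> B'. g y + h y)),
      smult = (\<lambda>c \<gamma>. \<Union>(B, g)\<in>\<gamma>. germ X x B (\<lambda>y\<in>B. c * g y))\<rparr>"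

text \<open>The common value at \<open>x\<close> of the representatives of a germ.\<close>

definition germ_value :: "'a \<Rightarrow> 'a germ \<Rightarrow> real" where
  "germ_value x \<gamma> = the_elem ((\<lambda>(B, g). g x) ` \<gamma>)"


section \<open>Tangent spaces\<close>

text \<open>
  \<open>derivations A ev\<close> is the vector space of linear maps \<open>D\<close> on the algebra \<open>A\<close> satisfying the
  Leibniz rule with respect to \<open>ev : A \<rightarrow> \<real>\<close>. A vector space is a module over the field of reals;
  the ring multiplication and unit that the record type demands play no role.
\<close>

definition derivations ::
  "(real, 'b) module \<Rightarrow> ('b \<Rightarrow> real) \<Rightarrow> (real, 'b \<Rightarrow> real) module" where
  "derivations A ev =
     \<lparr>carrier = {D \<in> extensional (carrier A).
        (\<forall>a\<in>carrier A. \<forall>b\<in>carrier A. D (a \<oplus>\<^bsub>A\<^esub> b) = D a + D b) \<and>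
        (\<forall>c. \<forall>a\<in>carrier A. D (c \<odot>\<^bsub>A\<^esub> a) = c * D a) \<and>
        (\<forall>a\<in>carrier A. \<forall>b\<in>carrier A. D (a \<otimes>\<^bsub>A\<^esub> b) = ev a * D b + ev b * D a)},
      mult = undefined,
      one = undefined,
      zero = (\<lambda>a\<in>carrier A. 0),
      add = (\<lambda>D E. \<lambda>a\<in>carrier A. D a + E a),
      smult = (\<lambda>c D. \<lambda>a\<in>carrier A. c * D a)\<rparr>"

definition right_tangent :: "'a dspace \<Rightarrow> 'a \<Rightarrow> (real, 'a germ \<Rightarrow> real) module" where
  "right_tangent X x = derivations (germ_algebra X x) (germ_value x)"

definition external_tangent :: "'a dspace \<Rightarrow> 'a \<Rightarrow> (real, 'a germ \<Rightarrow> real) module" where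
  "external_tangent X x = (right_tangent X x)
     \<lparr>carrier := {D \<in> carrier (right_tangent X x). smooth_map (germ_dspace X x) real_line D}\<rparr>"

definition global_right_tangent :: "'a dspace \<Rightarrow> 'a \<Rightarrow> (real, ('a \<Rightarrow> real) \<Rightarrow> real) module" where
  "global_right_tangent X x = derivations (smooth_algebra X) (\<lambda>g. g x)"

definition global_external_tangent :: "'a dspace \<Rightarrow> 'a \<Rightarrow> (real, ('a \<Rightarrow> real) \<Rightarrow> real) module" where
  "global_external_tangent X x = (global_right_tangent X x)
     \<lparr>carrier := {D \<in> carrier (global_right_tangent X x).
        smooth_map (function_dspace X real_line) real_line D}\<rparr>"

definition globalize :: "'a dspace \<Rightarrow> 'a \<Rightarrow> ('a germ \<Rightarrow> real) \<Rightarrow> ('a \<Rightarrow> real) \<Rightarrow> real" where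
  "globalize X x D = (\<lambda>g\<in>smooth_maps X real_line. D (germ X x (points X) g))"

definition real_field :: "real ring" where
  "real_field = \<lparr>carrier = UNIV, mult = (*), one = 1, zero = 0, add = (+)\<rparr>"

definition real_vector_space :: "(real, 'v) module \<Rightarrow> bool" where
  "real_vector_space V \<longleftrightarrow> Module.module real_field V"

definition linear_iso :: "(real, 'v) module \<Rightarrow> (real, 'w) module \<Rightarrow> ('v \<Rightarrow> 'w) \<Rightarrow> bool" where
  "linear_iso V W \<phi> \<longleftrightarrow>
     real_vector_space V \<and> real_vector_space W \<and> bij_betw \<phi> (carrier V) (carrier W) \<and>
     (\<forall>v\<in>carrier V. \<forall>w\<in>carrier V. \<phi> (v \<oplus>\<^bsub>V\<^esub> w) = \<phi> v \<oplus>\<^bsub>W\<^esub> \<phi> w) \<and>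
     (\<forall>c. \<forall>v\<in>carrier V. \<phi> (c \<odot>\<^bsub>V\<^esub> v) = c \<odot>\<^bsub>W\<^esub> \<phi> v)"

end

theory Submission
  imports Defs
begin

text \<open>
  Sending a global function to its germ at \<open>x\<close> is an algebra homomorphism \<open>\<rho>\<close> from \<open>C\<^sup>\<infinity>(X, \<real>)\<close> to
  \<open>G(X, x)\<close>, and \<open>globalize\<close> is composition with \<open>\<rho>\<close>. Composing a function supplied by smooth
  regularity with a cutoff of the real line gives a \<open>\<mu>\<close> which equals \<open>1\<close> near \<open>x\<close> and vanishes on an
  open set covering the complement of a given neighbourhood \<open>B\<close>; then \<open>\<mu> g\<close>, extended by zero, is a
  global function with the germ of \<open>g : B \<rightarrow> \<real>\<close>. Hence \<open>\<rho>\<close> is surjective. The Leibniz rule makes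
  every global derivation constant on the fibres of \<open>\<rho>\<close>, so composition with \<open>\<rho>\<close> is an isomorphism.
  It matches smooth derivations with smooth derivations because \<open>\<rho>\<close> is smooth, and because, for fixed
  \<open>B\<close>, the extension \<open>g \<mapsto> \<mu> g\<close> is smooth from \<open>C\<^sup>\<infinity>(B, \<real>)\<close> to \<open>C\<^sup>\<infinity>(X, \<real>)\<close>.
\<close>

section \<open>Calculus on Euclidean open sets\<close>

text \<open>The partial derivatives in \<open>Ck\<close> run along whole coordinate lines, while
  functions are controlled only on \<open>U\<close>. Openness of the slice allows replacing a
  function by one that agrees with it on \<open>U\<close> without changing the derivative. The
  condition \<open>i < n\<close> keeps the line inside \<open>Euclidean_space n\<close>.\<close>

lemma open_coordinate_line:
  assumes U: "openin (Euclidean_space n) U" and u: "u \<in> U" and i: "i < n"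
  shows "open {t. u(i := t) \<in> U}"
proof -
  have uE: "u \<in> topspace (Euclidean_space n)"
    using U u openin_subset by blast
  have "continuous_map euclideanreal euclideanreal (\<lambda>t. (u(i := t)) k)" for k
    by (cases "k = i") auto
  then have "continuous_map euclideanreal (Euclidean_space n) (\<lambda>t. u(i := t))"
    using uE i
    by (auto simp: Euclidean_space_def continuous_map_in_subtopology continuous_map_componentwise_UNIV)
  from openin_continuous_map_preimage[OF this U] show ?thesis
    by simp
qed

lemma Ck_continuous_map:
  "Ck k n U f \<Longrightarrow> continuous_map (subtopology (Euclidean_space n) U) euclideanreal f"
  by (cases k) auto

lemma Ck_SucD:
  assumes "Ck (Suc k) n U f" and "i < n"
  shows "\<exists>f'. (\<forall>u\<in>U. ((\<lambda>t. f (u(i := t))) has_real_derivative f' u) (at (u i))) \<and> Ck k n U f'"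
  using assms unfolding Ck.simps(2) by blast

lemma Ck_SucI:
  assumes "continuous_map (subtopology (Euclidean_space n) U) euclideanreal f"
    and "\<And>i. i < n \<Longrightarrow> \<exists>f'. (\<forall>u\<in>U. ((\<lambda>t. f (u(i := t))) has_real_derivative f' u) (at (u i))) \<and> Ck k n U f'"
  shows "Ck (Suc k) n U f"
  using assms by simp

lemma Ck_cong:
  assumes U: "openin (Euclidean_space n) U" and eq: "\<And>u. u \<in> U \<Longrightarrow> f u = g u" and f: "Ck k n U f"
  shows "Ck k n U g"
proof -
  have cont: "continuous_map (subtopology (Euclidean_space n) U) euclideanreal g"
    by (rule continuous_map_eq[OF Ck_continuous_map[OF f]]) (auto simp: eq)
  show ?thesis
  proof (cases k)
    case 0
    then show ?thesis using cont by simp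
  next
    case (Suc k')
    have "\<exists>f'. (\<forall>u\<in>U. ((\<lambda>t. g (u(i := t))) has_real_derivative f' u) (at (u i))) \<and> Ck k' n U f'"
      if i: "i < n" for i
    proof -
      obtain f' where f': "\<And>u. u \<in> U \<Longrightarrow> ((\<lambda>t. f (u(i := t))) has_real_derivative f' u) (at (u i))"
        and "Ck k' n U f'"
        using Ck_SucD[OF f[unfolded Suc] i] by blast
      moreover have "((\<lambda>t. g (u(i := t))) has_real_derivative f' u) (at (u i))" if u: "u \<in> U" for u
        by (rule has_field_derivative_transform_within_open
            [OF f'[OF u] open_coordinate_line[OF U u i]]) (use u eq in auto)
      ultimately show ?thesis by blast
    qed
    then show ?thesis using cont Suc by simp
  qed
qed

text \<open>The definition of \<open>Ck (Suc k)\<close> does not mention \<open>Ck k\<close> of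
  \<open>f\<close> itself. The loss of one order is passed on to the partial derivatives by
  induction, down to continuity.\<close>

lemma Ck_Suc_imp_Ck: "Ck (Suc k) n U f \<Longrightarrow> Ck k n U f"
proof (induction k arbitrary: f)
  case (Suc k)
  have "\<exists>f'. (\<forall>u\<in>U. ((\<lambda>t. f (u(i := t))) has_real_derivative f' u) (at (u i))) \<and> Ck k n U f'"
    if i: "i < n" for i
  proof -
    obtain f' where "\<And>u. u \<in> U \<Longrightarrow> ((\<lambda>t. f (u(i := t))) has_real_derivative f' u) (at (u i))"
      and "Ck (Suc k) n U f'"
      using Ck_SucD[OF Suc.prems i] by blast
    then show ?thesis using Suc.IH by blast
  qed
  then show ?case by (intro Ck_SucI Ck_continuous_map[OF Suc.prems])
qed simp

lemma Ck_subset: "Ck k n U f \<Longrightarrow> V \<subseteq> U \<Longrightarrow> Ck k n V f"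
proof (induction k arbitrary: f)
  case 0
  then show ?case by (auto intro: continuous_map_from_subtopology_mono)
next
  case (Suc k)
  show ?case
  proof (rule Ck_SucI)
    show "continuous_map (subtopology (Euclidean_space n) V) euclideanreal f"
      using Ck_continuous_map[OF Suc.prems(1)] Suc.prems(2) by (rule continuous_map_from_subtopology_mono)
    fix i assume "i < n"
    then obtain f' where
      "\<And>u. u \<in> U \<Longrightarrow> ((\<lambda>t. f (u(i := t))) has_real_derivative f' u) (at (u i))" "Ck k n U f'"
      using Ck_SucD[OF Suc.prems(1)] by blast
    then show "\<exists>f'. (\<forall>u\<in>V. ((\<lambda>t. f (u(i := t))) has_real_derivative f' u) (at (u i))) \<and> Ck k n V f'"
      using Suc.IH Suc.prems(2) by blast
  qed
qed

lemma Ck_const: "Ck k n U (\<lambda>u. c)"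
proof (induction k arbitrary: c)
  case (Suc k)
  have "\<exists>f'. (\<forall>u\<in>U. ((\<lambda>t. c) has_real_derivative f' u) (at (u i))) \<and> Ck k n U f'" for i
    by (rule exI[of _ "\<lambda>u. 0"]) (auto intro: Suc)
  then show ?case by simp
qed simp

lemma Ck_coordinate: "Ck k n U (\<lambda>u. u i)"
proof -
  have cont: "continuous_map (subtopology (Euclidean_space n) U) euclideanreal (\<lambda>u. u i)"
    unfolding Euclidean_space_def
    by (intro continuous_map_from_subtopology continuous_map_product_projection) simp
  show ?thesis
  proof (cases k)
    case 0
    then show ?thesis using cont by simp
  next
    case (Suc k')
    have "\<exists>f'. (\<forall>u\<in>U. ((\<lambda>t. (u(j := t)) i) has_real_derivative f' u) (at (u j))) \<and> Ck k' n U f'" for j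
      by (rule exI[of _ "\<lambda>u. if i = j then 1 else 0"]) (cases "i = j"; auto intro: Ck_const)
    then show ?thesis using cont Suc by simp
  qed
qed

lemma Ck_add: "Ck k n U f \<Longrightarrow> Ck k n U g \<Longrightarrow> Ck k n U (\<lambda>u. f u + g u)"
proof (induction k arbitrary: f g)
  case 0
  then show ?case by (simp add: continuous_map_add)
next
  case (Suc k)
  have "\<exists>h. (\<forall>u\<in>U. ((\<lambda>t. f (u(i := t)) + g (u(i := t))) has_real_derivative h u) (at (u i))) \<and> Ck k n U h"
    if i: "i < n" for i
  proof -
    obtain f' g' where "\<And>u. u \<in> U \<Longrightarrow> ((\<lambda>t. f (u(i := t))) has_real_derivative f' u) (at (u i))"
      "Ck k n U f'" "\<And>u. u \<in> U \<Longrightarrow> ((\<lambda>t. g (u(i := t))) has_real_derivative g' u) (at (u i))"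
      "Ck k n U g'"
      using Ck_SucD[OF Suc.prems(1) i] Ck_SucD[OF Suc.prems(2) i] by blast
    then show ?thesis
      by (intro exI[of _ "\<lambda>u. f' u + g' u"]) (auto intro: Suc.IH DERIV_add)
  qed
  then show ?case
    using Ck_continuous_map[OF Suc.prems(1)] Ck_continuous_map[OF Suc.prems(2)]
    by (intro Ck_SucI continuous_map_add)
qed

lemma Ck_mult: "Ck k n U f \<Longrightarrow> Ck k n U g \<Longrightarrow> Ck k n U (\<lambda>u. f u * g u)"
proof (induction k arbitrary: f g)
  case 0
  then show ?case by (simp add: continuous_map_real_mult)
next
  case (Suc k)
  have "\<exists>h. (\<forall>u\<in>U. ((\<lambda>t. f (u(i := t)) * g (u(i := t))) has_real_derivative h u) (at (u i))) \<and> Ck k n U h"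
    if i: "i < n" for i
  proof -
    obtain f' g' where *: "\<And>u. u \<in> U \<Longrightarrow> ((\<lambda>t. f (u(i := t))) has_real_derivative f' u) (at (u i))"
      "Ck k n U f'" "\<And>u. u \<in> U \<Longrightarrow> ((\<lambda>t. g (u(i := t))) has_real_derivative g' u) (at (u i))"
      "Ck k n U g'"
      using Ck_SucD[OF Suc.prems(1) i] Ck_SucD[OF Suc.prems(2) i] by blast
    \<comment> \<open>The product rule mixes the derivatives with \<open>f\<close> and
      \<open>g\<close> themselves, so these are lowered to order \<open>k\<close> for the induction
      hypothesis.\<close>
    moreover have "Ck k n U f" "Ck k n U g"
      using Suc.prems by (blast dest: Ck_Suc_imp_Ck)+
    ultimately have "Ck k n U (\<lambda>u. f' u * g u + g' u * f u)"
      by (intro Ck_add Suc.IH)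
    moreover have "((\<lambda>t. f (u(i := t)) * g (u(i := t))) has_real_derivative f' u * g u + g' u * f u)
        (at (u i))" if "u \<in> U" for u
      using DERIV_mult[OF *(1)[OF that] *(3)[OF that]] by simp
    ultimately show ?thesis
      by (intro exI[of _ "\<lambda>u. f' u * g u + g' u * f u"]) simp
  qed
  then show ?case
    using Ck_continuous_map[OF Suc.prems(1)] Ck_continuous_map[OF Suc.prems(2)]
    by (intro Ck_SucI continuous_map_real_mult)
qed

lemma continuous_map_locally:
  assumes "\<And>u. u \<in> topspace T \<Longrightarrow> \<exists>V. openin T V \<and> u \<in> V \<and> continuous_map (subtopology T V) S f"
  shows "continuous_map T S f"
  unfolding continuous_map_def
proof (intro conjI allI impI)
  show "f \<in> topspace T \<rightarrow> topspace S"
  proof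
    fix u assume "u \<in> topspace T"
    with assms obtain V where "openin T V" "u \<in> V" "continuous_map (subtopology T V) S f" by blast
    then show "f u \<in> topspace S"
      using \<open>u \<in> topspace T\<close> by (auto simp: continuous_map_def Pi_iff)
  qed
next
  fix W assume W: "openin S W"
  show "openin T {u \<in> topspace T. f u \<in> W}"
  proof (subst openin_subopen, intro ballI)
    fix u assume "u \<in> {u \<in> topspace T. f u \<in> W}"
    then have u: "u \<in> topspace T" "f u \<in> W" by auto
    with assms obtain V where V: "openin T V" "u \<in> V" "continuous_map (subtopology T V) S f" by blast
    have "openin T {v \<in> topspace T \<inter> V. f v \<in> W}"
      using openin_continuous_map_preimage[OF V(3) W] V(1) by (simp add: openin_open_subtopology)
    then show "\<exists>V'. openin T V' \<and> u \<in> V' \<and> V' \<subseteq> {u \<in> topspace T. f u \<in> W}"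
      using u V(2) by blast
  qed
qed

lemma Ck_local:
  assumes "openin (Euclidean_space n) U"
    and "\<And>u. u \<in> U \<Longrightarrow> \<exists>V. openin (Euclidean_space n) V \<and> u \<in> V \<and> V \<subseteq> U \<and> Ck k n V f"
  shows "Ck k n U f"
  using assms(2)
proof (induction k arbitrary: f)
  have cont: "continuous_map (subtopology (Euclidean_space n) U) euclideanreal f"
    if loc: "\<And>u. u \<in> U \<Longrightarrow> \<exists>V. openin (Euclidean_space n) V \<and> u \<in> V \<and> V \<subseteq> U \<and> Ck k n V f" for k f
  proof (rule continuous_map_locally)
    fix u assume "u \<in> topspace (subtopology (Euclidean_space n) U)"
    then obtain V where V: "openin (Euclidean_space n) V" "u \<in> V" "V \<subseteq> U" "Ck k n V f"
      using loc by auto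
    have "subtopology (subtopology (Euclidean_space n) U) V = subtopology (Euclidean_space n) V"
      using V(3) by (simp add: subtopology_subtopology Int_absorb1)
    then show "\<exists>V. openin (subtopology (Euclidean_space n) U) V \<and> u \<in> V \<and>
        continuous_map (subtopology (subtopology (Euclidean_space n) U) V) euclideanreal f"
      using V assms(1) Ck_continuous_map[OF V(4)]
      by (intro exI[of _ V]) (auto simp: openin_open_subtopology)
  qed
  {
    case 0
    then show ?case using cont[where f = f and k = 0] by (simp add: Ck.simps(1))
  next
    case (Suc k)
    have "\<exists>f'. (\<forall>u\<in>U. ((\<lambda>t. f (u(i := t))) has_real_derivative f' u) (at (u i))) \<and> Ck k n U f'"
      if i: "i < n" for i
    proof (intro exI conjI ballI)
      \<comment> \<open>The neighbourhoods supply unrelated local partial derivatives.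
        \<open>deriv\<close> is a single choice on all of \<open>U\<close> that agrees with each of
        them by uniqueness of derivatives, and so it inherits their regularity.\<close>
      let ?f' = "\<lambda>u. deriv (\<lambda>t. f (u(i := t))) (u i)"
      have loc: "\<exists>V f'. openin (Euclidean_space n) V \<and> u \<in> V \<and> V \<subseteq> U \<and> Ck k n V f' \<and>
          (\<forall>v\<in>V. ((\<lambda>t. f (v(i := t))) has_real_derivative f' v) (at (v i)))" if "u \<in> U" for u
      proof -
        from Suc.prems[OF that] obtain V
          where V: "openin (Euclidean_space n) V" "u \<in> V" "V \<subseteq> U" "Ck (Suc k) n V f" by blast
        from Ck_SucD[OF V(4) i] V(1-3) show ?thesis by blast
      qed
      show "((\<lambda>t. f (u(i := t))) has_real_derivative ?f' u) (at (u i))" if "u \<in> U" for u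
      proof -
        from loc[OF that] that obtain f' where
          "((\<lambda>t. f (u(i := t))) has_real_derivative f' u) (at (u i))" by blast
        then show ?thesis by (simp add: DERIV_imp_deriv)
      qed
      show "Ck k n U ?f'"
      proof (rule Suc.IH)
        fix u assume "u \<in> U"
        from loc[OF this] obtain V f' where V: "openin (Euclidean_space n) V" "u \<in> V" "V \<subseteq> U" "Ck k n V f'"
          "\<And>v. v \<in> V \<Longrightarrow> ((\<lambda>t. f (v(i := t))) has_real_derivative f' v) (at (v i))" by blast
        have "Ck k n V ?f'"
          by (rule Ck_cong[OF V(1) _ V(4)]) (rule DERIV_imp_deriv[OF V(5), symmetric])
        with V show "\<exists>V. openin (Euclidean_space n) V \<and> u \<in> V \<and> V \<subseteq> U \<and> Ck k n V ?f'" by blast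
      qed
    qed
    moreover have "continuous_map (subtopology (Euclidean_space n) U) euclideanreal f"
      using Suc.prems by (rule cont)
    ultimately show ?case by (intro Ck_SucI)
  }
qed

lemma Cinf_cong:
  assumes "openin (Euclidean_space n) U" "\<And>u. u \<in> U \<Longrightarrow> f u = g u" "Cinf n U f"
  shows "Cinf n U g"
  using assms Ck_cong unfolding Cinf_def by blast

lemma Cinf_subset: "Cinf n U f \<Longrightarrow> V \<subseteq> U \<Longrightarrow> Cinf n V f"
  using Ck_subset unfolding Cinf_def by blast

lemma Cinf_local:
  assumes "openin (Euclidean_space n) U"
    and "\<And>u. u \<in> U \<Longrightarrow> \<exists>V. openin (Euclidean_space n) V \<and> u \<in> V \<and> V \<subseteq> U \<and> Cinf n V f"
  shows "Cinf n U f"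
  unfolding Cinf_def
proof
  fix k
  show "Ck k n U f"
  proof (rule Ck_local[OF assms(1)])
    fix u assume "u \<in> U"
    with assms(2) obtain V where "openin (Euclidean_space n) V" "u \<in> V" "V \<subseteq> U" "Cinf n V f"
      by blast
    then show "\<exists>V. openin (Euclidean_space n) V \<and> u \<in> V \<and> V \<subseteq> U \<and> Ck k n V f"
      unfolding Cinf_def by blast
  qed
qed

lemma Cinf_const: "Cinf n U (\<lambda>u. c)"
  by (simp add: Cinf_def Ck_const)

lemma Cinf_coordinate: "Cinf n U (\<lambda>u. u i)"
  by (simp add: Cinf_def Ck_coordinate)

lemma Cinf_add: "Cinf n U f \<Longrightarrow> Cinf n U g \<Longrightarrow> Cinf n U (\<lambda>u. f u + g u)"
  by (simp add: Cinf_def Ck_add)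

lemma Cinf_mult: "Cinf n U f \<Longrightarrow> Cinf n U g \<Longrightarrow> Cinf n U (\<lambda>u. f u * g u)"
  by (simp add: Cinf_def Ck_mult)

lemma Cinf_diff: "Cinf n U f \<Longrightarrow> Cinf n U g \<Longrightarrow> Cinf n U (\<lambda>u. f u - g u)"
  using Cinf_add[of n U f "\<lambda>u. (-1) * g u"] Cinf_mult[OF Cinf_const[of n U "-1"], of g] by simp

lemma Cinf_continuous_map:
  "Cinf n U f \<Longrightarrow> continuous_map (subtopology (Euclidean_space n) U) euclideanreal f"
  unfolding Cinf_def using Ck_continuous_map by blast

lemma openin_Cinf_preimage:
  assumes "openin (Euclidean_space n) U" "Cinf n U f" "open A"
  shows "openin (Euclidean_space n) {u \<in> U. f u \<in> A}"
proof -
  have "topspace (Euclidean_space n) \<inter> U = U"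
    using openin_subset[OF assms(1)] by blast
  then show ?thesis
    using openin_continuous_map_preimage[OF Cinf_continuous_map[OF assms(2)], of A] assms(1,3)
    by (simp add: openin_open_subtopology)
qed


subsection \<open>A cutoff function\<close>

text \<open>\<open>flat 0\<close> is the classical function \<open>exp (- (1 / t))\<close> extended
  by 0. Dividing by \<open>t ^ j\<close> gives a family whose derivatives are linear combinations of
  its members, so all orders of smoothness follow from one induction.\<close>

definition flat :: "nat \<Rightarrow> real \<Rightarrow> real" where
  "flat j t = (if t > 0 then exp (- (1 / t)) / t ^ j else 0)"

text \<open>On the left the function is 0. On the right, \<open>t = 1 / s\<close> turns it into
  \<open>s ^ j / exp s\<close> at infinity, where the exponential wins.\<close>

lemma tendsto_flat_0: "(flat j \<longlongrightarrow> 0) (at 0)"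
proof (rule filterlim_split_at)
  have "\<forall>\<^sub>F t in at_left 0. 0 = flat j t"
    by (auto simp: flat_def eventually_at_filter)
  then show "(flat j \<longlongrightarrow> 0) (at_left 0)"
    by (rule Lim_transform_eventually[OF tendsto_const])
  have "\<forall>\<^sub>F s in at_top. s ^ j / exp s = flat j (inverse s)"
    using eventually_gt_at_top[of 0]
    by eventually_elim (simp add: flat_def exp_minus field_simps)
  then have "((\<lambda>s. flat j (inverse s)) \<longlongrightarrow> 0) at_top"
    by (rule Lim_transform_eventually[OF tendsto_power_div_exp_0])
  then show "(flat j \<longlongrightarrow> 0) (at_right 0)"
    by (simp add: filterlim_at_right_to_top)
qed

lemma DERIV_flat: "(flat j has_real_derivative flat (j + 2) t - real j * flat (j + 1) t) (at t)"
proof -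
  consider "t > 0" | "t < 0" | "t = 0" by linarith
  then show ?thesis
  proof cases
    case 1
    have "((\<lambda>t. exp (- (1 / t)) / t ^ j) has_real_derivative flat (j + 2) t - real j * flat (j + 1) t) (at t)"
    \<comment> \<open>Separating \<open>j = 0\<close> avoids the truncated exponent
      \<open>j - 1\<close> in the derivative of \<open>t ^ j\<close>.\<close>
    proof (cases j)
      case 0
      then show ?thesis
        using 1 by (auto intro!: derivative_eq_intros simp: flat_def field_simps power2_eq_square)
    next
      case (Suc m)
      have "t ^ Suc m * t ^ Suc m \<noteq> 0" using 1 by simp
      moreover have "((\<lambda>t. t ^ Suc m) has_real_derivative real (Suc m) * t ^ m) (at t)"
        using DERIV_pow[of "Suc m" t] by simp
      moreover have "((\<lambda>t. exp (- (1 / t))) has_real_derivative exp (- (1 / t)) / t^2) (at t)"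
        using 1 by (auto intro!: derivative_eq_intros simp: field_simps power2_eq_square)
      ultimately have "((\<lambda>t. exp (- (1 / t)) / t ^ Suc m) has_real_derivative
          (exp (- (1 / t)) / t^2 * t ^ Suc m - exp (- (1 / t)) * (real (Suc m) * t ^ m)) /
          (t ^ Suc m * t ^ Suc m)) (at t)"
        by (intro DERIV_divide) auto
      also have "(exp (- (1 / t)) / t^2 * t ^ Suc m - exp (- (1 / t)) * (real (Suc m) * t ^ m)) /
          (t ^ Suc m * t ^ Suc m) = flat (j + 2) t - real j * flat (j + 1) t"
        using 1 unfolding Suc flat_def by (simp add: divide_simps power2_eq_square) (simp add: algebra_simps)
      finally show ?thesis using Suc by simp
    qed
    then show ?thesis
      by (rule has_field_derivative_transform_within_open[where S = "{0<..}"]) (use 1 in \<open>auto simp: flat_def\<close>)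
  next
    case 2
    have "((\<lambda>t. 0) has_real_derivative 0) (at t)" by simp
    then have "(flat j has_real_derivative 0) (at t)"
      by (rule has_field_derivative_transform_within_open[where S = "{..<0}"]) (use 2 in \<open>auto simp: flat_def\<close>)
    then show ?thesis using 2 by (simp add: flat_def)
  next
    case 3
    \<comment> \<open>The difference quotient at 0 is again a member of the family, also at
      \<open>h = 0\<close>, where division by zero yields 0; its limit is known from
      \<open>tendsto_flat_0\<close>.\<close>
    have "(\<lambda>h. (flat j (0 + h) - flat j 0) / h) = flat (j + 1)"
      by (auto simp: flat_def fun_eq_iff)
    then have "(flat j has_real_derivative 0) (at 0)"
      unfolding DERIV_def using tendsto_flat_0[of "j + 1"] by simp
    then show ?thesis using 3 by (simp add: flat_def)
  qed
qed

text \<open>The chain rule brings in \<open>flat (j + 2)\<close> and \<open>flat (j + 1)\<close>, so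
  the induction on \<open>k\<close> has to treat all \<open>j\<close> at once.\<close>

lemma Ck_flat: "Ck k n U f \<Longrightarrow> Ck k n U (\<lambda>u. flat j (f u))"
proof (induction k arbitrary: f j)
  have cont: "continuous_map (subtopology (Euclidean_space n) U) euclideanreal (\<lambda>u. flat j (f u))"
    if "Ck k n U f" for k f j
  proof -
    have "continuous_map euclideanreal euclideanreal (flat j)"
      using DERIV_isCont[OF DERIV_flat] by (simp add: continuous_at_imp_continuous_on)
    from continuous_map_compose[OF Ck_continuous_map[OF that] this] show ?thesis
      by (simp add: o_def)
  qed
  {
    case 0
    then show ?case using cont[OF 0] by simp
  next
    case (Suc k)
    have "\<exists>h. (\<forall>u\<in>U. ((\<lambda>t. flat j (f (u(i := t)))) has_real_derivative h u) (at (u i))) \<and> Ck k n U h"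
      if i: "i < n" for i
    proof -
      obtain f' where f': "\<And>u. u \<in> U \<Longrightarrow> ((\<lambda>t. f (u(i := t))) has_real_derivative f' u) (at (u i))"
        and "Ck k n U f'"
        using Ck_SucD[OF Suc.prems i] by blast
      have "Ck k n U f" using Suc.prems by (rule Ck_Suc_imp_Ck)
      then have "Ck k n U (\<lambda>u. (flat (j + 2) (f u) + (- real j) * flat (j + 1) (f u)) * f' u)"
        by (intro Ck_mult Ck_add Ck_const Suc.IH \<open>Ck k n U f'\<close>)
      moreover have "((\<lambda>t. flat j (f (u(i := t)))) has_real_derivative
          (flat (j + 2) (f u) + (- real j) * flat (j + 1) (f u)) * f' u) (at (u i))" if "u \<in> U" for u
        using DERIV_chain2[OF DERIV_flat f'[OF that], of j] by simp
      ultimately show ?thesis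
        by (intro exI[of _ "\<lambda>u. (flat (j + 2) (f u) + (- real j) * flat (j + 1) (f u)) * f' u"]) simp
    qed
    then show ?case using cont[OF Suc.prems] by (intro Ck_SucI)
  }
qed

lemma flat_0_mono: "s \<le> t \<Longrightarrow> flat 0 s \<le> flat 0 t"
  by (auto simp: flat_def divide_simps)

text \<open>The inner \<open>flat\<close> vanishes for \<open>t \<ge> 3/4\<close> and exceeds \<open>flat 0 (1/2)\<close> for \<open>t \<le> 1/4\<close>, so the
  outer one produces a plateau on each side.\<close>

definition cutoff :: "real \<Rightarrow> real" where
  "cutoff t = flat 0 (flat 0 (1/2) - flat 0 (3/4 - t)) / flat 0 (flat 0 (1/2))"

lemma cutoff_eq_0: "t \<le> 1/4 \<Longrightarrow> cutoff t = 0"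
  using flat_0_mono[of "1/2" "3/4 - t"] by (simp add: cutoff_def flat_def[of 0 "flat _ _ - _"])

lemma cutoff_eq_1:
  assumes "t \<ge> 3/4"
  shows "cutoff t = 1"
proof -
  have "flat 0 (3/4 - t) = 0" "flat 0 (1/2) > 0"
    using assms by (auto simp: flat_def)
  then show ?thesis
    by (simp add: cutoff_def flat_def[of 0 "flat _ _"])
qed

lemma Cinf_cutoff:
  assumes "Cinf n U f"
  shows "Cinf n U (\<lambda>u. cutoff (f u))"
proof -
  have flat: "Cinf n U (\<lambda>u. flat 0 (g u))" if "Cinf n U g" for g
    using that by (simp add: Cinf_def Ck_flat)
  define c where "c = flat 0 (flat 0 (1/2))"
  have "Cinf n U (\<lambda>u. inverse c * flat 0 (flat 0 (1/2) - flat 0 (3/4 - f u)))"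
    by (intro Cinf_mult Cinf_diff Cinf_const flat assms)
  moreover have "cutoff t = inverse c * flat 0 (flat 0 (1/2) - flat 0 (3/4 - t))" for t
    unfolding cutoff_def c_def[symmetric] by (rule divide_inverse_commute)
  ultimately show ?thesis by simp
qed


section \<open>Spaces of derivations\<close>

lemma cring_real_field: "cring real_field"
proof (rule cringI)
  have "\<exists>y. y + x = 0" for x :: real
    by (rule exI[of _ "- x"]) simp
  then show "abelian_group real_field"
    by (intro abelian_groupI) (auto simp: real_field_def)
  show "comm_monoid real_field"
    by (intro comm_monoidI) (auto simp: real_field_def)
qed (auto simp: real_field_def distrib_right)

text \<open>For extensional functions with pointwise operations the axioms hold value by value; only
  closure of the carrier is left to check.\<close>

lemma real_vector_spaceI:
  fixes V :: "(real, 'b \<Rightarrow> real) module"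
  assumes ext: "carrier V \<subseteq> extensional S"
    and zero: "\<zero>\<^bsub>V\<^esub> = (\<lambda>a\<in>S. 0)"
    and add: "\<And>D E. D \<oplus>\<^bsub>V\<^esub> E = (\<lambda>a\<in>S. D a + E a)"
    and smult: "\<And>c D. c \<odot>\<^bsub>V\<^esub> D = (\<lambda>a\<in>S. c * D a)"
    and closed: "\<zero>\<^bsub>V\<^esub> \<in> carrier V"
      "\<And>D E. D \<in> carrier V \<Longrightarrow> E \<in> carrier V \<Longrightarrow> D \<oplus>\<^bsub>V\<^esub> E \<in> carrier V"
      "\<And>c D. D \<in> carrier V \<Longrightarrow> c \<odot>\<^bsub>V\<^esub> D \<in> carrier V"
  shows "real_vector_space V"
  unfolding real_vector_space_def
proof (rule moduleI)
  show "cring real_field" by (rule cring_real_field)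
  show "abelian_group V"
  proof (rule abelian_groupI)
    fix D assume D: "D \<in> carrier V"
    show "\<zero>\<^bsub>V\<^esub> \<oplus>\<^bsub>V\<^esub> D = D"
      unfolding zero add by (rule extensionalityI[of _ S]) (use D ext in auto)
    have "(-1) \<odot>\<^bsub>V\<^esub> D \<oplus>\<^bsub>V\<^esub> D = \<zero>\<^bsub>V\<^esub>"
      unfolding zero add smult by (rule extensionalityI[of _ S]) auto
    then show "\<exists>E\<in>carrier V. E \<oplus>\<^bsub>V\<^esub> D = \<zero>\<^bsub>V\<^esub>"
      using closed(3)[OF D] by blast
  next
    fix D E F
    show "D \<oplus>\<^bsub>V\<^esub> E \<oplus>\<^bsub>V\<^esub> F = D \<oplus>\<^bsub>V\<^esub> (E \<oplus>\<^bsub>V\<^esub> F)"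
      unfolding add by (rule extensionalityI[of _ S]) auto
    show "D \<oplus>\<^bsub>V\<^esub> E = E \<oplus>\<^bsub>V\<^esub> D"
      unfolding add by (rule extensionalityI[of _ S]) auto
  qed (fact closed(1,2))+
next
  fix c D
  assume "D \<in> carrier V"
  then show "c \<odot>\<^bsub>V\<^esub> D \<in> carrier V" by (rule closed(3))
  show "\<one>\<^bsub>real_field\<^esub> \<odot>\<^bsub>V\<^esub> D = D"
    unfolding smult by (rule extensionalityI[of _ S]) (use \<open>D \<in> carrier V\<close> ext in \<open>auto simp: real_field_def\<close>)
next
  fix c d D
  show "(c \<oplus>\<^bsub>real_field\<^esub> d) \<odot>\<^bsub>V\<^esub> D = c \<odot>\<^bsub>V\<^esub> D \<oplus>\<^bsub>V\<^esub> d \<odot>\<^bsub>V\<^esub> D"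
    unfolding smult add by (auto simp: real_field_def fun_eq_iff distrib_right)
  show "(c \<otimes>\<^bsub>real_field\<^esub> d) \<odot>\<^bsub>V\<^esub> D = c \<odot>\<^bsub>V\<^esub> (d \<odot>\<^bsub>V\<^esub> D)"
    unfolding smult by (auto simp: real_field_def fun_eq_iff)
next
  fix c D E
  show "c \<odot>\<^bsub>V\<^esub> (D \<oplus>\<^bsub>V\<^esub> E) = c \<odot>\<^bsub>V\<^esub> D \<oplus>\<^bsub>V\<^esub> c \<odot>\<^bsub>V\<^esub> E"
    unfolding smult add by (auto simp: fun_eq_iff distrib_left)
qed

lemma real_vector_space_derivations:
  assumes "\<And>a b. a \<in> carrier A \<Longrightarrow> b \<in> carrier A \<Longrightarrow> a \<oplus>\<^bsub>A\<^esub> b \<in> carrier A"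
    and "\<And>a b. a \<in> carrier A \<Longrightarrow> b \<in> carrier A \<Longrightarrow> a \<otimes>\<^bsub>A\<^esub> b \<in> carrier A"
    and "\<And>c a. a \<in> carrier A \<Longrightarrow> c \<odot>\<^bsub>A\<^esub> a \<in> carrier A"
  shows "real_vector_space (derivations A ev)"
  by (rule real_vector_spaceI[where S = "carrier A"])
    (auto simp: derivations_def assms algebra_simps)

text \<open>The submodule criterion also asks for closure under the abstract negation of
  \<open>V\<close>. Negation is multiplication by the scalar -1, so it is covered by
  \<open>smult\<close>.\<close>

lemma real_vector_space_subspace:
  assumes V: "real_vector_space V" and "H \<subseteq> carrier V" and "\<zero>\<^bsub>V\<^esub> \<in> H"
    and "\<And>v w. v \<in> H \<Longrightarrow> w \<in> H \<Longrightarrow> v \<oplus>\<^bsub>V\<^esub> w \<in> H"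
    and smult: "\<And>c v. v \<in> H \<Longrightarrow> c \<odot>\<^bsub>V\<^esub> v \<in> H"
  shows "real_vector_space (V\<lparr>carrier := H\<rparr>)"
proof -
  interpret module real_field V
    using V by (simp add: real_vector_space_def)
  have "\<ominus>\<^bsub>V\<^esub> v \<in> H" if "v \<in> H" for v
  proof -
    have "(\<ominus>\<^bsub>real_field\<^esub> \<one>\<^bsub>real_field\<^esub>) \<odot>\<^bsub>V\<^esub> v = \<ominus>\<^bsub>V\<^esub> v"
      using that assms(2) by (subst smult_l_minus) auto
    then show ?thesis using smult[OF that] by metis
  qed
  then have "submodule H real_field V"
    using assms by (intro submoduleI) auto
  from submodule.submodule_is_module[OF this module_axioms] show ?thesis
    by (simp add: real_vector_space_def)
qed

text \<open>Pullback along \<open>r\<close> is injective because \<open>r\<close> is onto, and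
  surjective because \<open>fibre\<close> lets every derivation of \<open>A\<close> descend through
  \<open>r\<close>. Closure of the operations of \<open>B\<close> is carried over from
  \<open>A\<close> by lifting elements along \<open>r\<close>.\<close>

lemma linear_iso_derivations_pullback:
  assumes closed: "\<And>a b. a \<in> carrier A \<Longrightarrow> b \<in> carrier A \<Longrightarrow> a \<oplus>\<^bsub>A\<^esub> b \<in> carrier A"
      "\<And>a b. a \<in> carrier A \<Longrightarrow> b \<in> carrier A \<Longrightarrow> a \<otimes>\<^bsub>A\<^esub> b \<in> carrier A"
      "\<And>c a. a \<in> carrier A \<Longrightarrow> c \<odot>\<^bsub>A\<^esub> a \<in> carrier A"
    and surj: "r ` carrier A = carrier B"
    and hom: "\<And>a b. a \<in> carrier A \<Longrightarrow> b \<in> carrier A \<Longrightarrow> r (a \<oplus>\<^bsub>A\<^esub> b) = r a \<oplus>\<^bsub>B\<^esub> r b"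
      "\<And>a b. a \<in> carrier A \<Longrightarrow> b \<in> carrier A \<Longrightarrow> r (a \<otimes>\<^bsub>A\<^esub> b) = r a \<otimes>\<^bsub>B\<^esub> r b"
      "\<And>c a. a \<in> carrier A \<Longrightarrow> r (c \<odot>\<^bsub>A\<^esub> a) = c \<odot>\<^bsub>B\<^esub> r a"
    and ev: "\<And>a. a \<in> carrier A \<Longrightarrow> evB (r a) = evA a"
    and fibre: "\<And>D. D \<in> carrier (derivations A evA) \<Longrightarrow>
      \<forall>a\<in>carrier A. \<forall>b\<in>carrier A. r a = r b \<longrightarrow> D a = D b"
  shows "linear_iso (derivations B evB) (derivations A evA) (\<lambda>D. \<lambda>a\<in>carrier A. D (r a))"
proof -
  let ?\<phi> = "\<lambda>D. \<lambda>a\<in>carrier A. D (r a)"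
  have r: "r a \<in> carrier B" if "a \<in> carrier A" for a
    using that surj by blast
  have lift: "\<exists>a\<in>carrier A. \<gamma> = r a" if "\<gamma> \<in> carrier B" for \<gamma>
    using that surj by blast
  have closedB: "\<gamma> \<oplus>\<^bsub>B\<^esub> \<delta> \<in> carrier B" "\<gamma> \<otimes>\<^bsub>B\<^esub> \<delta> \<in> carrier B" "c \<odot>\<^bsub>B\<^esub> \<gamma> \<in> carrier B"
    if "\<gamma> \<in> carrier B" "\<delta> \<in> carrier B" for \<gamma> \<delta> c
    using lift[OF that(1)] lift[OF that(2)] r closed
    by (auto simp flip: hom)
  have into: "?\<phi> D \<in> carrier (derivations A evA)" if "D \<in> carrier (derivations B evB)" for D
    using that by (auto simp: derivations_def closed hom r ev)
  have inj: "inj_on ?\<phi> (carrier (derivations B evB))"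
  proof (rule inj_onI)
    fix D E
    assume DE: "D \<in> carrier (derivations B evB)" "E \<in> carrier (derivations B evB)" "?\<phi> D = ?\<phi> E"
    have "D (r a) = E (r a)" if "a \<in> carrier A" for a
      using fun_cong[OF DE(3), of a] that by simp
    then have "D \<gamma> = E \<gamma>" if "\<gamma> \<in> carrier B" for \<gamma>
      using lift[OF that] by auto
    then show "D = E"
      using DE(1,2) by (intro extensionalityI[of D "carrier B" E]) (auto simp: derivations_def)
  qed
  have surj\<phi>: "D \<in> ?\<phi> ` carrier (derivations B evB)" if D: "D \<in> carrier (derivations A evA)" for D
  proof
    \<comment> \<open>\<open>inv_into\<close> picks an arbitrary preimage; by \<open>fibre\<close>
      the value of \<open>D\<close> does not depend on the choice.\<close>
    define E where "E = (\<lambda>\<gamma>\<in>carrier B. D (inv_into (carrier A) r \<gamma>))"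
    have E: "E (r a) = D a" if "a \<in> carrier A" for a
    proof -
      have "r a \<in> r ` carrier A" using that by blast
      from fibre[OF D, rule_format, OF inv_into_into[OF this] that f_inv_into_f[OF this]]
      have "D (inv_into (carrier A) r (r a)) = D a" .
      then show ?thesis using r[OF that] by (simp add: E_def)
    qed
    show "D = ?\<phi> E"
      using D by (intro extensionalityI[of D "carrier A"]) (auto simp: derivations_def E)
    have "E (\<gamma> \<oplus>\<^bsub>B\<^esub> \<delta>) = E \<gamma> + E \<delta>" "E (c \<odot>\<^bsub>B\<^esub> \<gamma>) = c * E \<gamma>"
      "E (\<gamma> \<otimes>\<^bsub>B\<^esub> \<delta>) = evB \<gamma> * E \<delta> + evB \<delta> * E \<gamma>"
      if "\<gamma> \<in> carrier B" "\<delta> \<in> carrier B" for \<gamma> \<delta> c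
    proof -
      obtain a b where ab: "a \<in> carrier A" "b \<in> carrier A" "\<gamma> = r a" "\<delta> = r b"
        using lift \<open>\<gamma> \<in> carrier B\<close> \<open>\<delta> \<in> carrier B\<close> by blast
      show "E (\<gamma> \<oplus>\<^bsub>B\<^esub> \<delta>) = E \<gamma> + E \<delta>" "E (c \<odot>\<^bsub>B\<^esub> \<gamma>) = c * E \<gamma>"
        "E (\<gamma> \<otimes>\<^bsub>B\<^esub> \<delta>) = evB \<gamma> * E \<delta> + evB \<delta> * E \<gamma>"
        unfolding ab(3,4) using D ab(1,2) closed
        by (simp_all add: derivations_def E ev flip: hom)
    qed
    then show "E \<in> carrier (derivations B evB)"
      by (simp add: derivations_def) (simp add: E_def)
  qed
  have bij: "bij_betw ?\<phi> (carrier (derivations B evB)) (carrier (derivations A evA))"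
    unfolding bij_betw_def using into inj surj\<phi> by blast
  have linear: "?\<phi> (D \<oplus>\<^bsub>derivations B evB\<^esub> E) = ?\<phi> D \<oplus>\<^bsub>derivations A evA\<^esub> ?\<phi> E"
    "?\<phi> (c \<odot>\<^bsub>derivations B evB\<^esub> D) = c \<odot>\<^bsub>derivations A evA\<^esub> ?\<phi> D" for c D E
    by (auto simp: derivations_def fun_eq_iff r)
  show ?thesis
    unfolding linear_iso_def
  proof (intro conjI ballI allI)
    show "real_vector_space (derivations B evB)"
      by (rule real_vector_space_derivations) (rule closedB; assumption)+
    show "real_vector_space (derivations A evA)"
      by (rule real_vector_space_derivations) (rule closed; assumption)+
  qed (rule bij linear)+
qed

lemma linear_iso_subspace:
  assumes "linear_iso V W \<phi>"
    and "real_vector_space (V\<lparr>carrier := {v \<in> carrier V. P v}\<rparr>)"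
    and "real_vector_space (W\<lparr>carrier := {w \<in> carrier W. Q w}\<rparr>)"
    and iff: "\<And>v. v \<in> carrier V \<Longrightarrow> Q (\<phi> v) \<longleftrightarrow> P v"
  shows "linear_iso (V\<lparr>carrier := {v \<in> carrier V. P v}\<rparr>) (W\<lparr>carrier := {w \<in> carrier W. Q w}\<rparr>) \<phi>"
proof -
  have bij: "bij_betw \<phi> (carrier V) (carrier W)"
    using assms(1) by (simp add: linear_iso_def)
  have "\<phi> ` {v \<in> carrier V. P v} = {w \<in> carrier W. Q w}"
    unfolding bij_betw_imp_surj_on[OF bij, symmetric] using iff by auto
  then have "bij_betw \<phi> {v \<in> carrier V. P v} {w \<in> carrier W. Q w}"
    by (intro bij_betw_subset[OF bij]) auto
  then show ?thesis
    using assms(1-3) by (simp add: linear_iso_def)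
qed

text \<open>The inverse is formed on a set \<open>S\<close> that may be larger than
  \<open>carrier V\<close>. Thus an isomorphism of subspaces can be inverted by the very function
  that inverts the isomorphism of the ambient spaces.\<close>

lemma linear_iso_inv_into:
  assumes iso: "linear_iso V W \<phi>" and sub: "carrier V \<subseteq> S" and inj: "inj_on \<phi> S"
  shows "linear_iso W V (inv_into S \<phi>)"
proof -
  have bij: "bij_betw \<phi> (carrier V) (carrier W)" and V: "real_vector_space V"
    using iso by (auto simp: linear_iso_def)
  interpret module real_field V
    using V by (simp add: real_vector_space_def)
  have inv: "inv_into S \<phi> (\<phi> v) = v" if "v \<in> carrier V" for v
    using that sub inj by (auto intro: inv_into_f_f)
  have lift: "\<exists>v\<in>carrier V. w = \<phi> v" if "w \<in> carrier W" for w
    using that bij by (auto simp: bij_betw_def)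
  have "bij_betw (inv_into S \<phi>) (carrier W) (carrier V)"
    using bij by (intro bij_betw_byWitness[where f' = \<phi>]) (auto simp: bij_betw_def inv dest!: lift)
  moreover have "inv_into S \<phi> (w \<oplus>\<^bsub>W\<^esub> w') = inv_into S \<phi> w \<oplus>\<^bsub>V\<^esub> inv_into S \<phi> w'"
    if ww': "w \<in> carrier W" "w' \<in> carrier W" for w w'
  proof -
    obtain v v' where v: "v \<in> carrier V" "v' \<in> carrier V" "w = \<phi> v" "w' = \<phi> v'"
      using lift ww' by blast
    then have "w \<oplus>\<^bsub>W\<^esub> w' = \<phi> (v \<oplus>\<^bsub>V\<^esub> v')"
      using iso by (simp add: linear_iso_def)
    then show ?thesis using v by (simp add: inv)
  qed
  moreover have "inv_into S \<phi> (c \<odot>\<^bsub>W\<^esub> w) = c \<odot>\<^bsub>V\<^esub> inv_into S \<phi> w" if w: "w \<in> carrier W" for c w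
  proof -
    obtain v where v: "v \<in> carrier V" "w = \<phi> v"
      using lift w by blast
    then have "c \<odot>\<^bsub>W\<^esub> w = \<phi> (c \<odot>\<^bsub>V\<^esub> v)"
      using iso by (simp add: linear_iso_def)
    moreover have "c \<odot>\<^bsub>V\<^esub> v \<in> carrier V"
      using v by (intro smult_closed) (simp_all add: real_field_def)
    ultimately show ?thesis using v by (simp add: inv)
  qed
  ultimately show ?thesis
    using iso by (simp add: linear_iso_def)
qed


section \<open>Smooth functions on diffeological spaces\<close>

lemma plots_quotient_dspace: "plots (quotient_dspace Y r) \<subseteq> parametrizations (points (quotient_dspace Y r))"
  by (auto simp: quotient_dspace_def)

lemma plots_function_dspace: "plots (function_dspace Y Z) \<subseteq> parametrizations (points (function_dspace Y Z))"
  by (auto simp: function_dspace_def)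

lemma plots_sub_dspace: "plots (sub_dspace X B) \<subseteq> parametrizations (points (sub_dspace X B))"
  by (auto simp: sub_dspace_def)

text \<open>\<open>Cinf\<close> depends only on values on \<open>U\<close>, so the default value of
  \<open>compose\<close> outside \<open>U\<close> is harmless. Assuming only that plots are
  parametrizations makes this and the following lemmas available for function, quotient and subspace
  diffeologies without verifying the diffeology axioms for them.\<close>

lemma smooth_map_real_line_iff:
  assumes "plots Y \<subseteq> parametrizations (points Y)"
  shows "smooth_map Y real_line f \<longleftrightarrow> (\<forall>(n, U, p)\<in>plots Y. Cinf n U (\<lambda>u. f (p u)))"
proof -
  have "(n, U, compose U f p) \<in> plots real_line \<longleftrightarrow> Cinf n U (\<lambda>u. f (p u))"
    if "(n, U, p) \<in> plots Y" for n U p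
  proof -
    have U: "openin (Euclidean_space n) U"
      using assms that by (auto simp: parametrizations_def)
    have "Cinf n U (compose U f p) \<longleftrightarrow> Cinf n U (\<lambda>u. f (p u))"
      using Cinf_cong[OF U, of "compose U f p" "\<lambda>u. f (p u)"] Cinf_cong[OF U, of "\<lambda>u. f (p u)" "compose U f p"]
      by (auto simp: compose_eq)
    then show ?thesis
      using U by (auto simp: real_line_def parametrizations_def compose_def)
  qed
  moreover have "f \<in> points Y \<rightarrow> points real_line"
    by (simp add: real_line_def)
  ultimately show ?thesis
    unfolding smooth_map_def by blast
qed

lemma smooth_map_real_line_cong:
  assumes "plots Y \<subseteq> parametrizations (points Y)" "\<And>a. a \<in> points Y \<Longrightarrow> f a = g a"
    "smooth_map Y real_line f"
  shows "smooth_map Y real_line g"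
proof -
  have "Cinf n U (\<lambda>u. g (p u))" if P: "(n, U, p) \<in> plots Y" for n U p
  proof (rule Cinf_cong)
    show "openin (Euclidean_space n) U" and "\<And>u. u \<in> U \<Longrightarrow> f (p u) = g (p u)"
      using assms(1,2) P by (auto simp: parametrizations_def)
    show "Cinf n U (\<lambda>u. f (p u))"
      using assms(3) P unfolding smooth_map_real_line_iff[OF assms(1)] by blast
  qed
  then show ?thesis
    unfolding smooth_map_real_line_iff[OF assms(1)] by blast
qed

lemma smooth_maps_real_line_iff:
  assumes "plots Y \<subseteq> parametrizations (points Y)"
  shows "f \<in> smooth_maps Y real_line \<longleftrightarrow>
    f \<in> extensional (points Y) \<and> (\<forall>(n, U, p)\<in>plots Y. Cinf n U (\<lambda>u. f (p u)))"
  unfolding smooth_maps_def smooth_map_real_line_iff[OF assms, symmetric]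
  by (auto simp: PiE_def real_line_def)

lemma restrict_smooth_maps:
  assumes "plots Y \<subseteq> parametrizations (points Y)" "smooth_map Y real_line f"
  shows "restrict f (points Y) \<in> smooth_maps Y real_line"
  using smooth_map_real_line_cong[OF assms(1) _ assms(2), of "restrict f (points Y)"]
  by (auto simp: smooth_maps_def real_line_def)

lemma smooth_map_real_line_const:
  "plots Y \<subseteq> parametrizations (points Y) \<Longrightarrow> smooth_map Y real_line (\<lambda>a. c)"
  by (simp add: smooth_map_real_line_iff Cinf_const split_beta)

lemma smooth_map_real_line_add:
  assumes "plots Y \<subseteq> parametrizations (points Y)" "smooth_map Y real_line f" "smooth_map Y real_line g"
  shows "smooth_map Y real_line (\<lambda>a. f a + g a)"
  using assms(2,3) unfolding smooth_map_real_line_iff[OF assms(1)] by (auto intro!: Cinf_add)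

lemma smooth_map_real_line_mult:
  assumes "plots Y \<subseteq> parametrizations (points Y)" "smooth_map Y real_line f" "smooth_map Y real_line g"
  shows "smooth_map Y real_line (\<lambda>a. f a * g a)"
  using assms(2,3) unfolding smooth_map_real_line_iff[OF assms(1)] by (auto intro!: Cinf_mult)

lemma smooth_map_of_smooth_maps: "f \<in> smooth_maps Y Z \<Longrightarrow> smooth_map Y Z f"
  by (simp add: smooth_maps_def)

lemma smooth_maps_add:
  assumes "plots Y \<subseteq> parametrizations (points Y)" "f \<in> smooth_maps Y real_line" "g \<in> smooth_maps Y real_line"
  shows "(\<lambda>a\<in>points Y. f a + g a) \<in> smooth_maps Y real_line"
  using assms by (intro restrict_smooth_maps smooth_map_real_line_add smooth_map_of_smooth_maps)

lemma smooth_maps_mult: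
  assumes "plots Y \<subseteq> parametrizations (points Y)" "f \<in> smooth_maps Y real_line" "g \<in> smooth_maps Y real_line"
  shows "(\<lambda>a\<in>points Y. f a * g a) \<in> smooth_maps Y real_line"
  using assms by (intro restrict_smooth_maps smooth_map_real_line_mult smooth_map_of_smooth_maps)

lemma smooth_maps_smult:
  assumes "plots Y \<subseteq> parametrizations (points Y)" "f \<in> smooth_maps Y real_line"
  shows "(\<lambda>a\<in>points Y. c * f a) \<in> smooth_maps Y real_line"
  using assms
  by (intro restrict_smooth_maps smooth_map_real_line_mult smooth_map_real_line_const smooth_map_of_smooth_maps)

lemma real_vector_space_smooth_derivations:
  assumes V: "real_vector_space (derivations A ev)" and Y: "plots Y \<subseteq> parametrizations (points Y)"
    and A: "carrier A = points Y"
  shows "real_vector_space ((derivations A ev)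
    \<lparr>carrier := {D \<in> carrier (derivations A ev). smooth_map Y real_line D}\<rparr>)"
proof -
  interpret module real_field "derivations A ev"
    using V by (simp add: real_vector_space_def)
  let ?H = "{D \<in> carrier (derivations A ev). smooth_map Y real_line D}"
  have smooth: "smooth_map Y real_line (restrict f (points Y))" if "smooth_map Y real_line f" for f
    using restrict_smooth_maps[OF Y that] by (rule smooth_map_of_smooth_maps)
  have ops: "\<zero>\<^bsub>derivations A ev\<^esub> = (\<lambda>a\<in>points Y. 0)"
    "D \<oplus>\<^bsub>derivations A ev\<^esub> E = (\<lambda>a\<in>points Y. D a + E a)"
    "c \<odot>\<^bsub>derivations A ev\<^esub> D = (\<lambda>a\<in>points Y. c * D a)" for c D E
    by (simp_all add: derivations_def A)
  show ?thesis
  proof (rule real_vector_space_subspace[OF V])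
    show "?H \<subseteq> carrier (derivations A ev)" by blast
    show "\<zero>\<^bsub>derivations A ev\<^esub> \<in> ?H"
      using M.zero_closed smooth[OF smooth_map_real_line_const[OF Y, of 0]] by (simp add: ops)
  next
    fix D E assume "D \<in> ?H" "E \<in> ?H"
    then show "D \<oplus>\<^bsub>derivations A ev\<^esub> E \<in> ?H"
      using M.add.m_closed[of D E] smooth[OF smooth_map_real_line_add[OF Y, of D E]] by (simp add: ops)
  next
    fix c D assume "D \<in> ?H"
    then show "c \<odot>\<^bsub>derivations A ev\<^esub> D \<in> ?H"
      using smult_closed[of c D]
        smooth[OF smooth_map_real_line_mult[OF Y smooth_map_real_line_const[OF Y, of c], of D]]
      by (simp add: ops real_field_def)
  qed
qed

section \<open>Plots of function spaces\<close>

lemma Cinf_map_subset: "Cinf_map m V n U f \<Longrightarrow> V' \<subseteq> V \<Longrightarrow> Cinf_map m V' n U f"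
  by (auto simp: Cinf_map_def intro: Cinf_subset)

lemma Cinf_map_cong:
  assumes "openin (Euclidean_space m) V" "\<And>v. v \<in> V \<Longrightarrow> f v = g v" "Cinf_map m V n U f"
  shows "Cinf_map m V n U g"
proof -
  have "Cinf m V (\<lambda>v. g v i)" if "i < n" for i
    by (rule Cinf_cong[OF assms(1), of "\<lambda>v. f v i"]) (use assms(2,3) that in \<open>auto simp: Cinf_map_def\<close>)
  then show ?thesis
    using assms(2,3) by (auto simp: Cinf_map_def Pi_iff)
qed

text \<open>A plot of the product of \<open>U\<close> and \<open>Y\<close> amounts to a smooth map
  into \<open>U\<close> and a plot of \<open>Y\<close> on the same domain, so smoothness of the
  uncurried map can be tested on such pairs.\<close>

lemma plots_function_dspace_iff:
  assumes Y: "plots Y \<subseteq> parametrizations (points Y)"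
  shows "(n, U, p) \<in> plots (function_dspace Y real_line) \<longleftrightarrow>
    openin (Euclidean_space n) U \<and> p \<in> U \<rightarrow>\<^sub>E smooth_maps Y real_line \<and>
    (\<forall>m V a b. Cinf_map m V n U a \<and> (m, V, b) \<in> plots Y \<longrightarrow> Cinf m V (\<lambda>v. p (a v) (b v)))"
proof -
  let ?E = "prod_dspace (euclidean_dspace n U) Y"
  have E: "plots ?E \<subseteq> parametrizations (points ?E)"
    by (auto simp: prod_dspace_def)
  have "(\<forall>(m, V, c)\<in>plots ?E. Cinf m V (\<lambda>v. case c v of (u, y) \<Rightarrow> p u y)) \<longleftrightarrow>
      (\<forall>m V a b. Cinf_map m V n U a \<and> (m, V, b) \<in> plots Y \<longrightarrow> Cinf m V (\<lambda>v. p (a v) (b v)))"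
    (is "?L \<longleftrightarrow> ?R")
  proof
    assume L: ?L
    show ?R
    proof (intro allI impI, elim conjE)
      fix m V a b
      assume a: "Cinf_map m V n U a" and b: "(m, V, b) \<in> plots Y"
      have V: "openin (Euclidean_space m) V" and bV: "b \<in> V \<rightarrow>\<^sub>E points Y"
        using b Y by (auto simp: parametrizations_def)
      \<comment> \<open>Parametrizations are extensional, so the pair is cut off outside
        \<open>V\<close>. Its second component is then literally \<open>b\<close>; the first agrees
        with \<open>a\<close> on \<open>V\<close>, which suffices for
        \<open>Cinf_map\<close>.\<close>
      let ?c = "\<lambda>v\<in>V. (a v, b v)"
      have "Cinf_map m V n U (compose V fst ?c)"
        by (rule Cinf_map_cong[OF V _ a]) (simp add: compose_eq)
      moreover have "compose V snd ?c = b"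
        by (rule extensionalityI[of _ V]) (use bV in \<open>auto simp: compose_eq PiE_def\<close>)
      moreover have "?c \<in> V \<rightarrow>\<^sub>E U \<times> points Y" "compose V fst ?c \<in> V \<rightarrow>\<^sub>E U"
        using a bV by (auto simp: Cinf_map_def compose_def)
      ultimately have "(m, V, ?c) \<in> plots ?E"
        unfolding prod_dspace_def euclidean_dspace_def using V b by (simp add: parametrizations_def)
      with L have "Cinf m V (\<lambda>v. case ?c v of (u, y) \<Rightarrow> p u y)" by blast
      then show "Cinf m V (\<lambda>v. p (a v) (b v))"
        by (rule Cinf_cong[OF V, rotated]) simp
    qed
  next
    assume R: ?R
    show ?L
    proof (intro ballI, clarify)
      fix m V c assume c: "(m, V, c) \<in> plots ?E"
      then have V: "openin (Euclidean_space m) V"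
        using E by (auto simp: parametrizations_def)
      from c have "Cinf_map m V n U (compose V fst c)" "(m, V, compose V snd c) \<in> plots Y"
        by (auto simp: prod_dspace_def euclidean_dspace_def)
      with R have "Cinf m V (\<lambda>v. p (compose V fst c v) (compose V snd c v))" by blast
      then show "Cinf m V (\<lambda>v. case c v of (u, y) \<Rightarrow> p u y)"
        by (rule Cinf_cong[OF V, rotated]) (simp add: compose_eq split_beta)
    qed
  qed
  then show ?thesis
    unfolding function_dspace_def by (simp add: parametrizations_def smooth_map_real_line_iff[OF E])
qed

lemma sub_dspace_points:
  fixes X :: "'a dspace"
  assumes "plots X \<subseteq> parametrizations (points X)"
  shows "sub_dspace X (points X) = X"
  using assms by (simp add: sub_dspace_def Int_absorb2)

section \<open>Restricted plots, open preimages and cutoffs on a diffeological space\<close>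

context
  fixes X :: "'a dspace"
  assumes X: "diffeological_space X"
begin

lemma plots_subset: "plots X \<subseteq> parametrizations (points X)"
  using X by (simp add: diffeological_space_def)

lemma restrict_plot:
  assumes p: "(n, U, p) \<in> plots X" and V: "openin (Euclidean_space n) V" "V \<subseteq> U"
  shows "(n, V, restrict p V) \<in> plots X"
proof -
  have "Cinf_map n V n U (\<lambda>v. v)"
    using V by (auto simp: Cinf_map_def Cinf_coordinate)
  with X p V have "(n, V, compose V p (\<lambda>v. v)) \<in> plots X"
    unfolding diffeological_space_def by blast
  then show ?thesis by (simp add: compose_def restrict_def)
qed

lemma plot_preimage_openin:
  "(n, U, p) \<in> plots X \<Longrightarrow> openin (D_topology X) B \<Longrightarrow> openin (Euclidean_space n) {u \<in> U. p u \<in> B}"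
  by (auto simp: openin_D_topology)

lemma restrict_plot_sub_dspace:
  assumes "(n, U, p) \<in> plots X" "openin (Euclidean_space n) V" "V \<subseteq> U" "\<And>v. v \<in> V \<Longrightarrow> p v \<in> B"
  shows "(n, V, restrict p V) \<in> plots (sub_dspace X B)"
  using restrict_plot[OF assms(1-3)] assms(2,4) by (auto simp: sub_dspace_def parametrizations_def)

lemma openin_points: "openin (D_topology X) (points X)"
proof -
  have "{u \<in> U. p u \<in> points X} = U" "openin (Euclidean_space n) U" if "(n, U, p) \<in> plots X" for n U p
    using that plots_subset by (auto simp: parametrizations_def)
  then show ?thesis by (auto simp: openin_D_topology)
qed

lemma openin_smooth_preimage:
  assumes f: "smooth_map X real_line f" and A: "open A"
  shows "openin (D_topology X) {y \<in> points X. f y \<in> A}"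
  unfolding openin_D_topology
proof (intro conjI ballI)
  fix P assume "P \<in> plots X"
  then obtain n U p where P: "P = (n, U, p)" "(n, U, p) \<in> plots X" by (cases P) auto
  then have "p \<in> U \<rightarrow> points X" and U: "openin (Euclidean_space n) U"
    using plots_subset by (auto simp: parametrizations_def)
  then have "{u \<in> U. p u \<in> {y \<in> points X. f y \<in> A}} = {u \<in> U. f (p u) \<in> A}" by auto
  moreover have "Cinf n U (\<lambda>u. f (p u))"
    using f P(2) unfolding smooth_map_real_line_iff[OF plots_subset] by blast
  ultimately show "case P of (n, U, p) \<Rightarrow> openin (Euclidean_space n) {u \<in> U. p u \<in> {y \<in> points X. f y \<in> A}}"
    using openin_Cinf_preimage[OF U _ A] P(1) by simp
qed blast

lemma smooth_maps_restrict:
  assumes "g \<in> smooth_maps (sub_dspace X B) real_line" "W \<subseteq> B"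
  shows "restrict g W \<in> smooth_maps (sub_dspace X W) real_line"
proof -
  have "plots (sub_dspace X W) \<subseteq> plots (sub_dspace X B)"
    using assms(2) by (auto simp: sub_dspace_def parametrizations_def PiE_def Pi_iff)
  then have "smooth_map (sub_dspace X W) real_line g"
    using assms(1)
    unfolding smooth_maps_real_line_iff[OF plots_sub_dspace] smooth_map_real_line_iff[OF plots_sub_dspace]
    by blast
  from restrict_smooth_maps[OF plots_sub_dspace this] show ?thesis
    by (simp add: sub_dspace_def)
qed

text \<open>Regularity controls \<open>l\<close> only at the point \<open>x\<close> and off
  \<open>B\<close>, and the complement of \<open>B\<close> need not be open. The preimages of the
  rays below 1/4 and above 3/4 are D-open, and composing with \<open>cutoff\<close> makes the
  function constant on each. Since \<open>l\<close> is 0 off \<open>B\<close>, the first preimage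
  covers the complement of \<open>B\<close> and the second lies inside \<open>B\<close>.\<close>

lemma smooth_cutoff:
  assumes reg: "smoothly_regular_at X x" and x: "x \<in> points X" and B: "B \<in> D_nbhds X x"
  obtains \<mu> A W where "smooth_map X real_line \<mu>" "openin (D_topology X) A" "A \<union> B = points X"
    "\<And>y. y \<in> A \<Longrightarrow> \<mu> y = 0" "W \<in> D_nbhds X x" "W \<subseteq> B" "\<And>y. y \<in> W \<Longrightarrow> \<mu> y = 1"
proof -
  obtain l where l: "smooth_map X real_line l" "l x = 1" "\<And>y. y \<in> points X - B \<Longrightarrow> l y = 0"
    using reg B unfolding smoothly_regular_at_def by blast
  have BX: "B \<subseteq> points X"
    using B by (simp add: D_nbhds_def openin_D_topology)
  let ?A = "{y \<in> points X. l y \<in> {..<1/4}}" and ?W = "{y \<in> points X. l y \<in> {3/4<..}}"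
  show thesis
  proof
    show "smooth_map X real_line (\<lambda>y. cutoff (l y))"
      using l(1) unfolding smooth_map_real_line_iff[OF plots_subset] by (auto intro!: Cinf_cutoff)
    show "openin (D_topology X) ?A" by (rule openin_smooth_preimage[OF l(1)]) simp
    show "?A \<union> B = points X" using BX l(3) by auto
    show "?W \<subseteq> B"
    proof
      fix y assume "y \<in> ?W"
      then show "y \<in> B" using l(3)[of y] by (cases "y \<in> B") auto
    qed
    show "?W \<in> D_nbhds X x"
      using openin_smooth_preimage[OF l(1), of "{3/4<..}"] l(2) x by (simp add: D_nbhds_def)
  qed (auto simp: cutoff_eq_0 cutoff_eq_1)
qed

end


section \<open>Germs\<close>

lemma points_local_functions:
  "(B, g) \<in> points (local_functions X x) \<longleftrightarrow>
     B \<in> D_nbhds X x \<and> g \<in> smooth_maps (sub_dspace X B) real_line"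
  by (simp add: local_functions_def sum_dspace_def function_dspace_def)

lemma D_nbhds_Int: "B \<in> D_nbhds X x \<Longrightarrow> B' \<in> D_nbhds X x \<Longrightarrow> B \<inter> B' \<in> D_nbhds X x"
  by (auto simp: D_nbhds_def)

lemma germ_rel_iff:
  "((B, g), (B', h)) \<in> germ_rel X x \<longleftrightarrow>
     (B, g) \<in> points (local_functions X x) \<and> (B', h) \<in> points (local_functions X x) \<and>
     (\<exists>W \<in> D_nbhds X x. W \<subseteq> B \<inter> B' \<and> (\<forall>y\<in>W. g y = h y))"
  by (auto simp: germ_rel_def)

lemma equiv_germ_rel: "equiv (points (local_functions X x)) (germ_rel X x)"
proof (rule equivI)
  show "germ_rel X x \<subseteq> points (local_functions X x) \<times> points (local_functions X x)"
    by (auto simp: germ_rel_def)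
  show "refl_on (points (local_functions X x)) (germ_rel X x)"
    by (auto simp: refl_on_def germ_rel_iff points_local_functions)
  show "sym (germ_rel X x)"
  proof (rule symI, clarify)
    fix B g B' h assume "((B, g), B', h) \<in> germ_rel X x"
    then show "((B', h), B, g) \<in> germ_rel X x"
      unfolding germ_rel_iff by (metis Int_commute)
  qed
  show "trans (germ_rel X x)"
  proof (rule transI, clarify)
    fix B g B' h B'' k
    assume "((B, g), B', h) \<in> germ_rel X x" "((B', h), B'', k) \<in> germ_rel X x"
    moreover from this obtain W W' where
      W: "W \<in> D_nbhds X x" "W \<subseteq> B \<inter> B'" "\<And>y. y \<in> W \<Longrightarrow> g y = h y" and
      W': "W' \<in> D_nbhds X x" "W' \<subseteq> B' \<inter> B''" "\<And>y. y \<in> W' \<Longrightarrow> h y = k y"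
      unfolding germ_rel_iff by blast
    have "\<exists>W \<in> D_nbhds X x. W \<subseteq> B \<inter> B'' \<and> (\<forall>y\<in>W. g y = k y)"
      using D_nbhds_Int[OF W(1) W'(1)] W(2,3) W'(2,3) by (intro bexI[of _ "W \<inter> W'"]) auto
    ultimately show "((B, g), B'', k) \<in> germ_rel X x"
      unfolding germ_rel_iff by blast
  qed
qed

lemma germ_eqI:
  assumes "(B, g) \<in> points (local_functions X x)" "(B', h) \<in> points (local_functions X x)"
    and "W \<in> D_nbhds X x" "W \<subseteq> B \<inter> B'" "\<And>y. y \<in> W \<Longrightarrow> g y = h y"
  shows "germ X x B g = germ X x B' h"
  unfolding germ_def using assms
  by (intro equiv_class_eq[OF equiv_germ_rel]) (auto simp: germ_rel_iff)

lemma mem_germ_iff: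
  "(B', h) \<in> germ X x B g \<longleftrightarrow> ((B, g), (B', h)) \<in> germ_rel X x"
  by (simp add: germ_def)

lemma germ_self:
  "(B, g) \<in> points (local_functions X x) \<Longrightarrow> (B, g) \<in> germ X x B g"
  unfolding germ_def by (rule equiv_class_self[OF equiv_germ_rel])

text \<open>Any two representatives agree on a neighbourhood containing \<open>x\<close>, so
  \<open>the_elem\<close> is applied to a singleton.\<close>

lemma germ_value_germ:
  assumes "(B, g) \<in> points (local_functions X x)"
  shows "germ_value x (germ X x B g) = g x"
proof -
  have "h x = g x" if "(B', h) \<in> germ X x B g" for B' h
    using that unfolding mem_germ_iff germ_rel_iff by (auto simp: D_nbhds_def)
  then have "(\<lambda>(B, g). g x) ` germ X x B g \<subseteq> {g x}"
    by auto
  moreover have "{g x} \<subseteq> (\<lambda>(B, g). g x) ` germ X x B g"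
    using image_eqI[OF _ germ_self[OF assms], of "g x" "\<lambda>(B, g). g x"] by simp
  ultimately have "(\<lambda>(B, g). g x) ` germ X x B g = {g x}" ..
  then show ?thesis by (simp add: germ_value_def)
qed

section \<open>The algebra of germs\<close>

lemma carrier_germ_algebra:
  "carrier (germ_algebra X x) =
     {germ X x B g | B g. (B, g) \<in> points (local_functions X x)}"
  unfolding germ_algebra_def germ_dspace_def quotient_dspace_def germ_def quotient_def by auto

lemma germ_mem_carrier:
  "(B, g) \<in> points (local_functions X x) \<Longrightarrow> germ X x B g \<in> carrier (germ_algebra X x)"
  unfolding carrier_germ_algebra by blast

text \<open>The three operations of \<open>germ_algebra\<close> are unions over all representatives; the union is over
  copies of a single germ.\<close>

lemma germ_binop:
  assumes f: "\<And>B g h. g \<in> smooth_maps (sub_dspace X B) real_line \<Longrightarrow>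
      h \<in> smooth_maps (sub_dspace X B) real_line \<Longrightarrow>
      (\<lambda>y\<in>B. f (g y) (h y)) \<in> smooth_maps (sub_dspace X B) real_line"
    and X: "diffeological_space X"
    and g: "(B, g) \<in> points (local_functions X x)" and h: "(B, h) \<in> points (local_functions X x)"
  shows "(\<Union>(C, g')\<in>germ X x B g. \<Union>(C', h')\<in>germ X x B h. germ X x (C \<inter> C') (\<lambda>y\<in>C \<inter> C'. f (g' y) (h' y)))
    = germ X x B (\<lambda>y\<in>B. f (g y) (h y))"
proof -
  have eq: "germ X x (C \<inter> C') (\<lambda>y\<in>C \<inter> C'. f (g' y) (h' y)) = germ X x B (\<lambda>y\<in>B. f (g y) (h y))"
    if g': "(C, g') \<in> germ X x B g" and h': "(C', h') \<in> germ X x B h" for C g' C' h'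
  proof -
    obtain W W' where
      W: "W \<in> D_nbhds X x" "W \<subseteq> B \<inter> C" "\<And>y. y \<in> W \<Longrightarrow> g y = g' y" and
      W': "W' \<in> D_nbhds X x" "W' \<subseteq> B \<inter> C'" "\<And>y. y \<in> W' \<Longrightarrow> h y = h' y"
      using g' h' unfolding mem_germ_iff germ_rel_iff by blast
    have loc: "(C, g') \<in> points (local_functions X x)" "(C', h') \<in> points (local_functions X x)"
      using g' h' unfolding mem_germ_iff germ_rel_iff by blast+
    \<comment> \<open>The closure assumption on \<open>f\<close> wants both functions on one domain,
      so they are first cut down to \<open>C \<inter> C'\<close>; the inner restrictions then
      disappear by \<open>restrict_cong\<close>.\<close>
    then have "restrict g' (C \<inter> C') \<in> smooth_maps (sub_dspace X (C \<inter> C')) real_line"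
      "restrict h' (C \<inter> C') \<in> smooth_maps (sub_dspace X (C \<inter> C')) real_line"
      by (auto simp: points_local_functions intro: smooth_maps_restrict[OF X])
    from f[OF this] have "(\<lambda>y\<in>C \<inter> C'. f (g' y) (h' y)) \<in> smooth_maps (sub_dspace X (C \<inter> C')) real_line"
      by (simp cong: restrict_cong)
    then show ?thesis
      using loc g h W W'
      by (intro germ_eqI[where W = "W \<inter> W'"]) (auto simp: points_local_functions intro: D_nbhds_Int f)
  qed
  have "(\<Union>(C, g')\<in>germ X x B g. \<Union>(C', h')\<in>germ X x B h.
      germ X x (C \<inter> C') (\<lambda>y\<in>C \<inter> C'. f (g' y) (h' y))) =
      (\<Union>_\<in>germ X x B g. \<Union>_\<in>germ X x B h. germ X x B (\<lambda>y\<in>B. f (g y) (h y)))"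
    by (rule SUP_cong[OF refl], clarify, rule SUP_cong[OF refl], clarify) (rule eq)
  \<comment> \<open>A union of copies of one set collapses only over nonempty index sets; the given
    representatives show that both germs are nonempty.\<close>
  then show ?thesis
    using germ_self[OF g] germ_self[OF h] by auto
qed

lemma germ_unop:
  assumes f: "\<And>B g. g \<in> smooth_maps (sub_dspace X B) real_line \<Longrightarrow>
      (\<lambda>y\<in>B. f (g y)) \<in> smooth_maps (sub_dspace X B) real_line"
    and g: "(B, g) \<in> points (local_functions X x)"
  shows "(\<Union>(C, g')\<in>germ X x B g. germ X x C (\<lambda>y\<in>C. f (g' y))) = germ X x B (\<lambda>y\<in>B. f (g y))"
proof -
  have eq: "germ X x C (\<lambda>y\<in>C. f (g' y)) = germ X x B (\<lambda>y\<in>B. f (g y))"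
    if g': "(C, g') \<in> germ X x B g" for C g'
  proof -
    obtain W where
      W: "W \<in> D_nbhds X x" "W \<subseteq> B \<inter> C" "\<And>y. y \<in> W \<Longrightarrow> g y = g' y"
      using g' unfolding mem_germ_iff germ_rel_iff by blast
    have loc: "(C, g') \<in> points (local_functions X x)"
      using g' unfolding mem_germ_iff germ_rel_iff by blast
    then show ?thesis
      using g W by (intro germ_eqI[where W = W]) (auto simp: points_local_functions intro: f)
  qed
  have "(\<Union>(C, g')\<in>germ X x B g. germ X x C (\<lambda>y\<in>C. f (g' y))) =
      (\<Union>_\<in>germ X x B g. germ X x B (\<lambda>y\<in>B. f (g y)))"
    by (rule SUP_cong[OF refl], clarify) (rule eq)
  then show ?thesis
    using germ_self[OF g] by auto
qed

text \<open>Representatives with a common domain \<open>B\<close> are enough for comparison with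
  global functions, which all have domain \<open>points X\<close>.\<close>

lemma germ_algebra_ops:
  assumes X: "diffeological_space X" and g: "(B, g) \<in> points (local_functions X x)"
  shows germ_smult: "c \<odot>\<^bsub>germ_algebra X x\<^esub> germ X x B g = germ X x B (\<lambda>y\<in>B. c * g y)"
    and germ_add: "(B, h) \<in> points (local_functions X x) \<Longrightarrow>
      germ X x B g \<oplus>\<^bsub>germ_algebra X x\<^esub> germ X x B h = germ X x B (\<lambda>y\<in>B. g y + h y)"
    and germ_mult: "(B, h) \<in> points (local_functions X x) \<Longrightarrow>
      germ X x B g \<otimes>\<^bsub>germ_algebra X x\<^esub> germ X x B h = germ X x B (\<lambda>y\<in>B. g y * h y)"
proof -
  have pts: "points (sub_dspace X C) = C" for C
    by (simp add: sub_dspace_def)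
  note closed = smooth_maps_add[OF plots_sub_dspace[of X], unfolded pts]
    smooth_maps_mult[OF plots_sub_dspace[of X], unfolded pts]
    smooth_maps_smult[OF plots_sub_dspace[of X], unfolded pts]
  have ops: "smult (germ_algebra X x) = (\<lambda>c \<gamma>. \<Union>(B, g)\<in>\<gamma>. germ X x B (\<lambda>y\<in>B. c * g y))"
    "add (germ_algebra X x) =
      (\<lambda>\<gamma> \<delta>. \<Union>(B, g)\<in>\<gamma>. \<Union>(B', h)\<in>\<delta>. germ X x (B \<inter> B') (\<lambda>y\<in>B \<inter> B'. g y + h y))"
    "mult (germ_algebra X x) =
      (\<lambda>\<gamma> \<delta>. \<Union>(B, g)\<in>\<gamma>. \<Union>(B', h)\<in>\<delta>. germ X x (B \<inter> B') (\<lambda>y\<in>B \<inter> B'. g y * h y))"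
    by (simp_all only: germ_algebra_def module.simps ring.simps monoid.simps)
  show "c \<odot>\<^bsub>germ_algebra X x\<^esub> germ X x B g = germ X x B (\<lambda>y\<in>B. c * g y)"
    unfolding ops by (rule germ_unop[OF closed(3) g])
  assume h: "(B, h) \<in> points (local_functions X x)"
  show "germ X x B g \<oplus>\<^bsub>germ_algebra X x\<^esub> germ X x B h = germ X x B (\<lambda>y\<in>B. g y + h y)"
    unfolding ops by (rule germ_binop[OF closed(1) X g h])
  show "germ X x B g \<otimes>\<^bsub>germ_algebra X x\<^esub> germ X x B h = germ X x B (\<lambda>y\<in>B. g y * h y)"
    unfolding ops by (rule germ_binop[OF closed(2) X g h])
qed

lemma globalize_eq: "globalize X x D = (\<lambda>g\<in>carrier (smooth_algebra X). D (germ X x (points X) g))"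
  by (simp add: globalize_def smooth_algebra_def)

text \<open>Outside \<open>B\<close> the function \<open>g\<close> carries no information, so 0 is
  put in explicitly. Smoothness across the boundary of \<open>B\<close> will come from
  \<open>\<mu>\<close> vanishing on an open set that covers the complement of
  \<open>B\<close>.\<close>

definition extend_by_zero :: "'a dspace \<Rightarrow> ('a \<Rightarrow> real) \<Rightarrow> 'a set \<Rightarrow> ('a \<Rightarrow> real) \<Rightarrow> 'a \<Rightarrow> real" where
  "extend_by_zero X \<mu> B g = (\<lambda>y\<in>points X. if y \<in> B then \<mu> y * g y else 0)"

section \<open>Global functions and germs at a smoothly regular point\<close>

locale smoothly_regular_point =
  fixes X :: "'a dspace" and x :: 'a
  assumes X: "diffeological_space X" and x: "x \<in> points X" and regular: "smoothly_regular_at X x"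
begin

lemma points_nbhd: "points X \<in> D_nbhds X x"
  using openin_points[OF X] x by (simp add: D_nbhds_def)

lemma sub_dspace_X: "sub_dspace X (points X) = X"
  by (rule sub_dspace_points[OF plots_subset[OF X]])

text \<open>This makes the germ lemmas applicable to global functions, viewed as local functions on
  the largest neighbourhood of \<open>x\<close>.\<close>

lemma smooth_maps_local: "g \<in> smooth_maps X real_line \<longleftrightarrow> (points X, g) \<in> points (local_functions X x)"
  by (simp add: points_local_functions points_nbhd sub_dspace_X)

lemma carrier_smooth_algebra: "carrier (smooth_algebra X) = smooth_maps X real_line"
  by (simp add: smooth_algebra_def)

lemma smooth_algebra_closed:
  assumes "g \<in> carrier (smooth_algebra X)"
  shows "h \<in> carrier (smooth_algebra X) \<Longrightarrow> g \<oplus>\<^bsub>smooth_algebra X\<^esub> h \<in> carrier (smooth_algebra X)"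
    and "h \<in> carrier (smooth_algebra X) \<Longrightarrow> g \<otimes>\<^bsub>smooth_algebra X\<^esub> h \<in> carrier (smooth_algebra X)"
    and "c \<odot>\<^bsub>smooth_algebra X\<^esub> g \<in> carrier (smooth_algebra X)"
  using assms
  by (simp_all add: smooth_algebra_def smooth_maps_add[OF plots_subset[OF X]]
      smooth_maps_mult[OF plots_subset[OF X]] smooth_maps_smult[OF plots_subset[OF X]])

lemma germ_hom:
  assumes "g \<in> carrier (smooth_algebra X)"
  shows "h \<in> carrier (smooth_algebra X) \<Longrightarrow> germ X x (points X) (g \<oplus>\<^bsub>smooth_algebra X\<^esub> h) =
      germ X x (points X) g \<oplus>\<^bsub>germ_algebra X x\<^esub> germ X x (points X) h"
    and "h \<in> carrier (smooth_algebra X) \<Longrightarrow> germ X x (points X) (g \<otimes>\<^bsub>smooth_algebra X\<^esub> h) =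
      germ X x (points X) g \<otimes>\<^bsub>germ_algebra X x\<^esub> germ X x (points X) h"
    and "germ X x (points X) (c \<odot>\<^bsub>smooth_algebra X\<^esub> g) =
      c \<odot>\<^bsub>germ_algebra X x\<^esub> germ X x (points X) g"
  using assms germ_smult[OF X, of "points X" g x c] germ_add[OF X, of "points X" g x h]
    germ_mult[OF X, of "points X" g x h]
  by (simp_all add: smooth_algebra_def smooth_maps_local)

text \<open>On the open set \<open>A\<close> the extension is \<open>0\<close>, on \<open>B\<close> it is a product of smooth functions, and
  these two sets cover \<open>X\<close>.\<close>

lemma Cinf_extend_by_zero:
  assumes \<mu>: "smooth_map X real_line \<mu>" and A: "openin (D_topology X) A" "A \<union> B = points X"
    "\<And>y. y \<in> A \<Longrightarrow> \<mu> y = 0" and B: "openin (D_topology X) B"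
    and b: "(m, V, b) \<in> plots X"
    and F: "\<And>V'. openin (Euclidean_space m) V' \<Longrightarrow> V' \<subseteq> V \<Longrightarrow>
      (m, V', restrict b V') \<in> plots (sub_dspace X B) \<Longrightarrow> Cinf m V' (\<lambda>v. F v (restrict b V' v))"
  shows "Cinf m V (\<lambda>v. extend_by_zero X \<mu> B (F v) (b v))"
proof (rule Cinf_local)
  show V: "openin (Euclidean_space m) V"
    using b plots_subset[OF X] by (auto simp: parametrizations_def)
  have bV: "b v \<in> points X" if "v \<in> V" for v
    using b plots_subset[OF X] that by (auto simp: parametrizations_def)
  let ?f = "\<lambda>v. extend_by_zero X \<mu> B (F v) (b v)"
  let ?A = "{v \<in> V. b v \<in> A}" and ?B = "{v \<in> V. b v \<in> B}"
  have AB: "openin (Euclidean_space m) ?A" "openin (Euclidean_space m) ?B"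
    using plot_preimage_openin[OF X b] A(1) B by auto
  \<comment> \<open>On \<open>A\<close> both branches give 0: inside \<open>B\<close> because
    \<open>\<mu>\<close> vanishes there, outside \<open>B\<close> by definition.\<close>
  have "Cinf m ?A ?f"
    by (rule Cinf_cong[OF AB(1) _ Cinf_const[of _ _ 0]]) (use A(2,3) bV in \<open>auto simp: extend_by_zero_def\<close>)
  moreover have "Cinf m ?B ?f"
  proof (rule Cinf_cong[OF AB(2)])
    have "Cinf m V (\<lambda>v. \<mu> (b v))"
      using \<mu> b unfolding smooth_map_real_line_iff[OF plots_subset[OF X]] by blast
    then have "Cinf m ?B (\<lambda>v. \<mu> (b v))"
      by (rule Cinf_subset) auto
    moreover have "Cinf m ?B (\<lambda>v. F v (restrict b ?B v))"
      by (intro F restrict_plot_sub_dspace[OF X b] AB(2)) auto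
    ultimately show "Cinf m ?B (\<lambda>v. \<mu> (b v) * F v (restrict b ?B v))"
      by (rule Cinf_mult)
  qed (auto simp: extend_by_zero_def bV)
  ultimately have "openin (Euclidean_space m) V' \<and> V' \<subseteq> V \<and> Cinf m V' ?f" if "V' \<in> {?A, ?B}" for V'
    using AB that by auto
  moreover fix v assume "v \<in> V"
  then have "\<exists>V'\<in>{?A, ?B}. v \<in> V'"
    using bV A(2) by auto
  ultimately show "\<exists>V'. openin (Euclidean_space m) V' \<and> v \<in> V' \<and> V' \<subseteq> V \<and> Cinf m V' ?f"
    by blast
qed

text \<open>The case of \<open>Cinf_extend_by_zero\<close> in which the family \<open>F\<close> is
  constantly \<open>g\<close>.\<close>

lemma extend_by_zero_smooth:
  assumes \<mu>: "smooth_map X real_line \<mu>" and A: "openin (D_topology X) A" "A \<union> B = points X"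
    "\<And>y. y \<in> A \<Longrightarrow> \<mu> y = 0" and B: "openin (D_topology X) B"
    and g: "g \<in> smooth_maps (sub_dspace X B) real_line"
  shows "extend_by_zero X \<mu> B g \<in> smooth_maps X real_line"
proof -
  have "Cinf m V (\<lambda>v. extend_by_zero X \<mu> B g (b v))" if b: "(m, V, b) \<in> plots X" for m V b
    by (rule Cinf_extend_by_zero[OF \<mu> A B b])
      (use g in \<open>auto simp: smooth_maps_real_line_iff[OF plots_sub_dspace]\<close>)
  then show ?thesis
    unfolding smooth_maps_real_line_iff[OF plots_subset[OF X]] by (auto simp: extend_by_zero_def)
qed

text \<open>This is smoothness of the extension operator between function spaces. The function being
  extended moves with the parameter of the plot, which is why \<open>Cinf_extend_by_zero\<close>
  lets \<open>F\<close> depend on \<open>v\<close>; here \<open>F v = q (a v)\<close>.\<close>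

lemma extend_by_zero_plot:
  assumes \<mu>: "smooth_map X real_line \<mu>" and A: "openin (D_topology X) A" "A \<union> B = points X"
    "\<And>y. y \<in> A \<Longrightarrow> \<mu> y = 0" and B: "openin (D_topology X) B"
    and q: "(n, U, q) \<in> plots (function_dspace (sub_dspace X B) real_line)"
  shows "(n, U, \<lambda>u\<in>U. extend_by_zero X \<mu> B (q u)) \<in> plots (function_dspace X real_line)"
  unfolding plots_function_dspace_iff[OF plots_subset[OF X]]
proof (intro conjI allI impI)
  note q' = q[unfolded plots_function_dspace_iff[OF plots_sub_dspace]]
  show "openin (Euclidean_space n) U" using q' by blast
  show "(\<lambda>u\<in>U. extend_by_zero X \<mu> B (q u)) \<in> U \<rightarrow>\<^sub>E smooth_maps X real_line"
    using q' extend_by_zero_smooth[OF \<mu> A B] by auto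
  fix m V a b
  assume "Cinf_map m V n U a \<and> (m, V, b) \<in> plots X"
  then have a: "Cinf_map m V n U a" and b: "(m, V, b) \<in> plots X" by auto
  have V: "openin (Euclidean_space m) V"
    using b plots_subset[OF X] by (auto simp: parametrizations_def)
  have "Cinf m V (\<lambda>v. extend_by_zero X \<mu> B (q (a v)) (b v))"
  proof (rule Cinf_extend_by_zero[OF \<mu> A B b])
    fix V' assume "V' \<subseteq> V" "(m, V', restrict b V') \<in> plots (sub_dspace X B)"
    then show "Cinf m V' (\<lambda>v. q (a v) (restrict b V' v))"
      using q' Cinf_map_subset[OF a] by blast
  qed
  then show "Cinf m V (\<lambda>v. (\<lambda>u\<in>U. extend_by_zero X \<mu> B (q u)) (a v) (b v))"
    by (rule Cinf_cong[OF V, rotated]) (use a in \<open>auto simp: Cinf_map_def\<close>)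
qed

text \<open>The cutoff depends only on \<open>B\<close>, so a single operator \<open>E\<close>
  serves all \<open>g\<close> on \<open>B\<close>. This uniformity is essential for the second
  conjunct, since a plot runs through many functions \<open>g\<close>.\<close>

lemma germ_extension:
  assumes B: "B \<in> D_nbhds X x"
  shows "\<exists>E. (\<forall>g\<in>smooth_maps (sub_dspace X B) real_line.
        E g \<in> smooth_maps X real_line \<and> germ X x (points X) (E g) = germ X x B g) \<and>
      (\<forall>(n, U, q)\<in>plots (function_dspace (sub_dspace X B) real_line).
        (n, U, \<lambda>u\<in>U. E (q u)) \<in> plots (function_dspace X real_line))"
proof -
  from smooth_cutoff[OF X regular x B] obtain \<mu> A W where
    \<mu>: "smooth_map X real_line \<mu>" and A: "openin (D_topology X) A" "A \<union> B = points X"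
      "\<And>y. y \<in> A \<Longrightarrow> \<mu> y = 0"
    and W: "W \<in> D_nbhds X x" "W \<subseteq> B" "\<And>y. y \<in> W \<Longrightarrow> \<mu> y = 1" by blast
  have BX: "openin (D_topology X) B" "B \<subseteq> points X"
    using B by (auto simp: D_nbhds_def openin_D_topology)
  have E: "extend_by_zero X \<mu> B g \<in> smooth_maps X real_line"
    if "g \<in> smooth_maps (sub_dspace X B) real_line" for g
    by (rule extend_by_zero_smooth[OF \<mu> A BX(1) that])
  have germ: "germ X x (points X) (extend_by_zero X \<mu> B g) = germ X x B g"
    if g: "g \<in> smooth_maps (sub_dspace X B) real_line" for g
  proof (rule germ_eqI[OF _ _ W(1)])
    show "(points X, extend_by_zero X \<mu> B g) \<in> points (local_functions X x)"
      using E[OF g] by (simp add: smooth_maps_local)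
    show "(B, g) \<in> points (local_functions X x)"
      using g B by (simp add: points_local_functions)
    show "W \<subseteq> points X \<inter> B" using W(2) BX(2) by blast
    fix y assume "y \<in> W"
    then show "extend_by_zero X \<mu> B g y = g y"
      using W(2,3) BX(2) by (auto simp: extend_by_zero_def)
  qed
  have plot: "(n, U, \<lambda>u\<in>U. extend_by_zero X \<mu> B (q u)) \<in> plots (function_dspace X real_line)"
    if "(n, U, q) \<in> plots (function_dspace (sub_dspace X B) real_line)" for n U q
    using that by (intro extend_by_zero_plot[OF \<mu> A BX(1)])
  show ?thesis
    by (rule exI[of _ "extend_by_zero X \<mu> B"]) (use E germ plot in blast)
qed

lemma germ_surj: "germ X x (points X) ` carrier (smooth_algebra X) = carrier (germ_algebra X x)"
proof
  show "germ X x (points X) ` carrier (smooth_algebra X) \<subseteq> carrier (germ_algebra X x)"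
    by (auto simp: carrier_smooth_algebra smooth_maps_local intro: germ_mem_carrier)
  show "carrier (germ_algebra X x) \<subseteq> germ X x (points X) ` carrier (smooth_algebra X)"
  proof
    fix \<gamma> assume "\<gamma> \<in> carrier (germ_algebra X x)"
    then obtain B g where B: "B \<in> D_nbhds X x" and g: "g \<in> smooth_maps (sub_dspace X B) real_line"
      and \<gamma>: "\<gamma> = germ X x B g"
      by (auto simp: carrier_germ_algebra points_local_functions)
    obtain E where E: "E g \<in> smooth_maps X real_line" "germ X x (points X) (E g) = germ X x B g"
      using germ_extension[OF B] g by blast
    with E show "\<gamma> \<in> germ X x (points X) ` carrier (smooth_algebra X)"
      unfolding \<gamma> carrier_smooth_algebra by (intro image_eqI[of _ _ "E g"]) simp_all
  qed
qed

text \<open>If \<open>a\<close> and \<open>b\<close> agree on \<open>W\<close> and \<open>l\<close> vanishes off \<open>W\<close>, then \<open>l a = l b\<close>, and the Leibniz rule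
  recovers \<open>D a = D b\<close>.\<close>

lemma derivation_local:
  assumes D: "D \<in> carrier (global_right_tangent X x)"
  shows "\<forall>a\<in>carrier (smooth_algebra X). \<forall>b\<in>carrier (smooth_algebra X).
    germ X x (points X) a = germ X x (points X) b \<longrightarrow> D a = D b"
proof (intro ballI impI)
  fix a b
  assume ab: "a \<in> carrier (smooth_algebra X)" "b \<in> carrier (smooth_algebra X)"
    and eq: "germ X x (points X) a = germ X x (points X) b"
  have loc: "(points X, a) \<in> points (local_functions X x)" "(points X, b) \<in> points (local_functions X x)"
    using ab by (simp_all add: carrier_smooth_algebra smooth_maps_local)
  have "(points X, b) \<in> germ X x (points X) a"
    using germ_self[OF loc(2)] eq by simp
  then obtain W where W: "W \<in> D_nbhds X x" "\<And>y. y \<in> W \<Longrightarrow> a y = b y"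
    unfolding mem_germ_iff germ_rel_iff by blast
  \<comment> \<open>The function given by regularity is used without a cutoff: the Leibniz rule sees
    only its value at \<open>x\<close>, and the products need only its vanishing off
    \<open>W\<close>.\<close>
  obtain l where l: "smooth_map X real_line l" "l x = 1" "\<And>y. y \<in> points X - W \<Longrightarrow> l y = 0"
    using regular W(1) unfolding smoothly_regular_at_def by blast
  let ?l = "restrict l (points X)"
  have lc: "?l \<in> carrier (smooth_algebra X)"
    unfolding carrier_smooth_algebra by (rule restrict_smooth_maps[OF plots_subset[OF X] l(1)])
  have "l y * a y = l y * b y" if "y \<in> points X" for y
    using l(3)[of y] W(2)[of y] that by (cases "y \<in> W") auto
  then have "?l \<otimes>\<^bsub>smooth_algebra X\<^esub> a = ?l \<otimes>\<^bsub>smooth_algebra X\<^esub> b"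
    by (auto simp: smooth_algebra_def fun_eq_iff)
  then have "D (?l \<otimes>\<^bsub>smooth_algebra X\<^esub> a) = D (?l \<otimes>\<^bsub>smooth_algebra X\<^esub> b)"
    by (rule arg_cong)
  \<comment> \<open>The terms containing \<open>D ?l\<close> coincide for \<open>a\<close> and
    \<open>b\<close> because \<open>a x = b x\<close>, and \<open>l x = 1\<close> leaves
    \<open>D a\<close> and \<open>D b\<close>.\<close>
  moreover have "D (?l \<otimes>\<^bsub>smooth_algebra X\<^esub> f) = ?l x * D f + f x * D ?l"
    if "f \<in> carrier (smooth_algebra X)" for f
    using D lc that by (simp add: global_right_tangent_def derivations_def)
  moreover have "a x = b x"
    using W by (simp add: D_nbhds_def)
  ultimately show "D a = D b"
    using ab l(2) x by simp
qed

section \<open>The isomorphism of tangent spaces and its smooth part\<close>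

lemma linear_iso_globalize: "linear_iso (right_tangent X x) (global_right_tangent X x) (globalize X x)"
  unfolding right_tangent_def global_right_tangent_def globalize_eq[abs_def]
proof (rule linear_iso_derivations_pullback[where r = "germ X x (points X)" and A = "smooth_algebra X"
      and B = "germ_algebra X x", OF smooth_algebra_closed germ_surj germ_hom])
  show "germ_value x (germ X x (points X) a) = a x" if "a \<in> carrier (smooth_algebra X)" for a
    using that by (intro germ_value_germ) (simp add: carrier_smooth_algebra smooth_maps_local)
qed ((rule derivation_local[unfolded global_right_tangent_def])?, assumption)+

text \<open>This is smoothness of the germ homomorphism. A plot of global functions lifts as a whole
  to the summand of \<open>points X\<close>, so \<open>V = U\<close> witnesses the local conditions
  of both the sum and the quotient diffeology.\<close>

lemma germ_plot:
  assumes "(n, U, p) \<in> plots (function_dspace X real_line)"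
  shows "(n, U, \<lambda>u\<in>U. germ X x (points X) (p u)) \<in> plots (germ_dspace X x)"
proof -
  have U: "openin (Euclidean_space n) U" and p: "\<And>u. u \<in> U \<Longrightarrow> p u \<in> smooth_maps X real_line"
    using assms by (auto simp: function_dspace_def parametrizations_def)
  have q: "(n, U, \<lambda>u\<in>U. (points X, p u)) \<in> plots (local_functions X x)"
    unfolding local_functions_def sum_dspace_def
  proof (clarsimp, intro conjI ballI)
    show "(n, U, \<lambda>u\<in>U. (points X, p u)) \<in> parametrizations
      (SIGMA i:D_nbhds X x. points (function_dspace (sub_dspace X i) real_line))"
      using U p by (auto simp: parametrizations_def points_nbhd sub_dspace_X function_dspace_def)
    fix u assume "u \<in> U"
    then show "\<exists>V. openin (Euclidean_space n) V \<and> u \<in> V \<and> V \<subseteq> U \<and> (\<exists>i. i \<in> D_nbhds X x \<and>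
      (\<exists>q. (n, V, q) \<in> plots (function_dspace (sub_dspace X i) real_line) \<and>
        (\<forall>v\<in>V. (v \<in> U \<longrightarrow> points X = i \<and> p v = q v) \<and> (v \<notin> U \<longrightarrow> undefined = (i, q v)))))"
      using U assms points_nbhd sub_dspace_X
      by (intro exI[of _ U] conjI exI[of _ "points X"] exI[of _ p]) auto
  qed
  have "germ X x (points X) (p u) \<in> points (germ_dspace X x)" if "u \<in> U" for u
    using germ_mem_carrier[of "points X" "p u" X x] p[OF that]
    by (simp add: smooth_maps_local germ_algebra_def)
  then have "(n, U, \<lambda>u\<in>U. germ X x (points X) (p u)) \<in> parametrizations (points (germ_dspace X x))"
    using U by (auto simp: parametrizations_def)
  moreover have "\<exists>V q. openin (Euclidean_space n) V \<and> u \<in> V \<and> V \<subseteq> U \<and> (n, V, q) \<in> plots (local_functions X x) \<and>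
      (\<forall>v\<in>V. (\<lambda>u\<in>U. germ X x (points X) (p u)) v = germ_rel X x `` {q v})" if "u \<in> U" for u
    by (intro exI[of _ U] exI[of _ "\<lambda>u\<in>U. (points X, p u)"]) (use U q that in \<open>simp add: germ_def\<close>)
  ultimately show ?thesis
    unfolding germ_dspace_def quotient_dspace_def by simp
qed

text \<open>From right to left, \<open>globalize X x D\<close> is \<open>D\<close> after the smooth
  germ homomorphism. Conversely, a plot of germs is locally the germ of a plot of functions on some
  \<open>B\<close>; extending these by \<open>E\<close> keeps the germs, so along the plot
  \<open>D\<close> equals \<open>globalize X x D\<close> along a plot of global functions.\<close>

lemma smooth_globalize_iff:
  "smooth_map (function_dspace X real_line) real_line (globalize X x D) \<longleftrightarrow>
   smooth_map (germ_dspace X x) real_line D"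
  (is "?L \<longleftrightarrow> ?R")
proof
  assume ?R
  have "Cinf n U (\<lambda>u. globalize X x D (p u))" if p: "(n, U, p) \<in> plots (function_dspace X real_line)" for n U p
  proof (rule Cinf_cong)
    show "openin (Euclidean_space n) U"
      using p by (auto simp: function_dspace_def parametrizations_def)
    show "Cinf n U (\<lambda>u. D ((\<lambda>u\<in>U. germ X x (points X) (p u)) u))"
      using \<open>?R\<close> germ_plot[OF p]
      unfolding germ_dspace_def smooth_map_real_line_iff[OF plots_quotient_dspace] by blast
    fix u assume "u \<in> U"
    then show "D ((\<lambda>u\<in>U. germ X x (points X) (p u)) u) = globalize X x D (p u)"
      using p by (auto simp: globalize_def function_dspace_def parametrizations_def)
  qed
  then show ?L
    unfolding smooth_map_real_line_iff[OF plots_function_dspace] by blast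
next
  assume ?L
  have "Cinf n U (\<lambda>u. D (p u))" if p: "(n, U, p) \<in> plots (germ_dspace X x)" for n U p
  proof (rule Cinf_local)
    show "openin (Euclidean_space n) U"
      using p by (auto simp: germ_dspace_def quotient_dspace_def parametrizations_def)
    fix u assume "u \<in> U"
    \<comment> \<open>Two localizations follow: the quotient provides a lift \<open>q\<close> near
      \<open>u\<close>, and the sum diffeology then confines \<open>q\<close> to one summand
      \<open>B\<close> on a smaller \<open>V'\<close>.\<close>
    then obtain V q where V: "openin (Euclidean_space n) V" "u \<in> V" "V \<subseteq> U"
      and q: "(n, V, q) \<in> plots (local_functions X x)" "\<And>v. v \<in> V \<Longrightarrow> p v = germ_rel X x `` {q v}"
      using p unfolding germ_dspace_def quotient_dspace_def by auto
    from q(1) \<open>u \<in> V\<close> obtain V' B q' where V': "openin (Euclidean_space n) V'" "u \<in> V'" "V' \<subseteq> V"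
      and B: "B \<in> D_nbhds X x"
      and q': "(n, V', q') \<in> plots (function_dspace (sub_dspace X B) real_line)"
        "\<And>v. v \<in> V' \<Longrightarrow> q v = (B, q' v)"
      unfolding local_functions_def sum_dspace_def by auto
    obtain E where E: "\<And>g. g \<in> smooth_maps (sub_dspace X B) real_line \<Longrightarrow> E g \<in> smooth_maps X real_line"
      "\<And>g. g \<in> smooth_maps (sub_dspace X B) real_line \<Longrightarrow> germ X x (points X) (E g) = germ X x B g"
      "(n, V', \<lambda>u\<in>V'. E (q' u)) \<in> plots (function_dspace X real_line)"
      using germ_extension[OF B] q'(1) by fast
    have "Cinf n V' (\<lambda>v. D (p v))"
    proof (rule Cinf_cong[OF V'(1)])
      show "Cinf n V' (\<lambda>v. globalize X x D ((\<lambda>u\<in>V'. E (q' u)) v))"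
        using \<open>?L\<close> E(3) unfolding smooth_map_real_line_iff[OF plots_function_dspace] by blast
      fix v assume v: "v \<in> V'"
      then have "q' v \<in> smooth_maps (sub_dspace X B) real_line"
        using q'(1) by (auto simp: function_dspace_def parametrizations_def)
      moreover have "p v = germ X x B (q' v)"
        using q(2) q'(2)[OF v] v V'(3) by (auto simp: germ_def)
      ultimately show "globalize X x D ((\<lambda>u\<in>V'. E (q' u)) v) = D (p v)"
        using v E(1,2) by (simp add: globalize_def)
    qed
    then show "\<exists>V. openin (Euclidean_space n) V \<and> u \<in> V \<and> V \<subseteq> U \<and> Cinf n V (\<lambda>u. D (p u))"
      using V V' by blast
  qed
  then show ?R
    unfolding germ_dspace_def smooth_map_real_line_iff[OF plots_quotient_dspace] by blast
qed

lemma linear_iso_globalize_external: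
  "linear_iso (external_tangent X x) (global_external_tangent X x) (globalize X x)"
  unfolding external_tangent_def global_external_tangent_def
proof (rule linear_iso_subspace[OF linear_iso_globalize])
  have vs: "real_vector_space (right_tangent X x)" "real_vector_space (global_right_tangent X x)"
    using linear_iso_globalize by (auto simp: linear_iso_def)
  show "real_vector_space ((right_tangent X x)
    \<lparr>carrier := {D \<in> carrier (right_tangent X x). smooth_map (germ_dspace X x) real_line D}\<rparr>)"
    unfolding right_tangent_def
  proof (rule real_vector_space_smooth_derivations)
    show "real_vector_space (derivations (germ_algebra X x) (germ_value x))"
      using vs(1) by (simp only: right_tangent_def)
    show "plots (germ_dspace X x) \<subseteq> parametrizations (points (germ_dspace X x))"
      unfolding germ_dspace_def by (rule plots_quotient_dspace)
    show "carrier (germ_algebra X x) = points (germ_dspace X x)"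
      by (simp add: germ_algebra_def)
  qed
  show "real_vector_space ((global_right_tangent X x)
    \<lparr>carrier := {D \<in> carrier (global_right_tangent X x). smooth_map (function_dspace X real_line) real_line D}\<rparr>)"
    unfolding global_right_tangent_def
  proof (rule real_vector_space_smooth_derivations[OF _ plots_function_dspace])
    show "real_vector_space (derivations (smooth_algebra X) (\<lambda>g. g x))"
      using vs(2) by (simp only: global_right_tangent_def)
    show "carrier (smooth_algebra X) = points (function_dspace X real_line)"
      by (simp add: smooth_algebra_def function_dspace_def)
  qed
qed (rule smooth_globalize_iff)

end

theorem theorem4p26:
  fixes X :: "'a dspace" and x :: 'a
  assumes "diffeological_space X" and "x \<in> points X" and "smoothly_regular_at X x"
  shows "linear_iso (right_tangent X x) (global_right_tangent X x) (globalize X x) \<and>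
    linear_iso (external_tangent X x) (global_external_tangent X x) (globalize X x) \<and>
    linear_iso (global_external_tangent X x) (external_tangent X x)
      (inv_into (carrier (right_tangent X x)) (globalize X x))"
proof -
  interpret smoothly_regular_point X x
    using assms by unfold_locales
  \<comment> \<open>The inverse in the third isomorphism is formed on the whole right tangent space,
    so injectivity is needed there; that isomorphism is then given by the inverse of the first
    one.\<close>
  have "inj_on (globalize X x) (carrier (right_tangent X x))"
    using linear_iso_globalize by (simp add: linear_iso_def bij_betw_def)
  moreover have "carrier (external_tangent X x) \<subseteq> carrier (right_tangent X x)"
    by (auto simp: external_tangent_def)
  ultimately show ?thesis
    by (intro conjI linear_iso_globalize linear_iso_globalize_external
        linear_iso_inv_into[OF linear_iso_globalize_external])
qed

end
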